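(* Given $p>2$ (whence $p'=(1-\frac1p)^{-1}<2$), the set of eigenvalues $\gamma$ such that the spherical function $\phi(\cdot,v_0\,|\,\gamma)$ belongs to $\ell^p(V)$ is, with the possible exception of $\gamma=0$, $$\Bigl\{\gamma\in\mathbb C:\ \mathfrak q^{\frac1p-\frac1{p'}}<|B(\gamma)|<\mathfrak q^{\frac1{p'}-\frac1p}\Bigr\}.$$ Apart from $\gamma=0$, the set of eigenvalues such that $\phi(\cdot,v_0\,|\,\gamma)$ belongs to $\bigcap_{p>2}\ell^p(V)$ is $$\{\gamma\in\mathbb C:\ |B(\gamma)|=1\}.$$ There is exactly one spherical function that belongs to $\ell^2(V)$ if and only if $q_+<q_-$, and more generally to $\ell^p(V)$ for every $p>p_{\rm crit}=\frac{\ln(q_+q_-)}{\ln q_-}$, namely the function $\phi(\cdot,v_0\,|\,0)$. In other words, $0$ belongs to the discrete spectrum of $\mu_1$ on $\ell^2(V)$ for $q_+<q_-$; if $q_+>q_-$, then $0$ belongs to the continuous spectrum of $\mu_1$, but not to the discrete spectrum. The spherical function with eigenvalue $\gamma$ is bounded if and only if $\gamma$ belongs to $$\Bigl\{\gamma\in\mathbb C:\ \frac1{\mathfrak q}\le|B(\gamma)|\le\mathfrak q\Bigr\}.$$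
   Context: Let $q_+,q_-\ge 2$ be integers, and let $T$ be the semi-homogeneous tree: the infinite tree whose vertex set $V$ is the disjoint union of $V_+$ and $V_-$, each vertex of $V_\pm$ having exactly $q_\pm+1$ neighbors, all in $V_\mp$ ($q_+=q_-$ is allowed). Fix $v_0\in V_+$ and write $|v|=\operatorname{dist}(v,v_0)$, $\mathfrak q=\sqrt{q_+q_-}$. The Laplace operator is $\mu_1f(v)=$ the average of $f$ over the neighbors of $v$. For $\gamma\in\mathbb C$, the spherical function $\phi(\cdot,v_0\,|\,\gamma)$ is the unique function on $V$ depending only on $|v|$, with value $1$ at $v_0$, such that $\mu_1\phi=\gamma\phi$. Set $Q(\gamma)=(q_++1)(q_-+1)\gamma^2$, $W(\gamma)=Q(\gamma)^2-2(q_++q_-)Q(\gamma)+(q_+-q_-)^2$, $$a=\frac{|\sqrt{q_+}-\sqrt{q_-}|}{\sqrt{(q_++1)(q_-+1)}},\qquad b=\frac{\sqrt{q_+}+\sqrt{q_-}}{\sqrt{(q_++1)(q_-+1)}}.$$ Let $R(\gamma)$ be the determination of $\sqrt{W(\gamma)}$ with branch cuts on the intervals $(-b,-a)$ and $(a,b)$ that is positive for real $\gamma>b$, and $$B(\gamma)=\frac{Q(\gamma)-(q_++q_-)-R(\gamma)}{2\mathfrak q}.$$ On the cuts both determinations of $\sqrt W$ give a value of modulus $1$, and $|B(\gamma)|$ is understood as $1$ there.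
   Formalization: "Discrete spectrum" is read as eigenvalues with a nonzero ℓ²(V) eigenfunction radial around v_0, "continuous spectrum" as the rest of the ℓ²(V) spectrum; read literally the case q_+>q_- is false, since 0 then has an ℓ² eigenfunction centred at a vertex of V_-. *)

theory Defs
  imports "HOL-Analysis.Analysis"
begin

section \<open>Semi-homogeneous trees\<close>

text \<open>A graph is given by its adjacency relation; the vertex set is the whole type. A path is a
  list of pairwise distinct vertices, and a tree is a simple graph in which any two vertices are
  joined by exactly one path.\<close>

definition path_between :: "('v \<Rightarrow> 'v \<Rightarrow> bool) \<Rightarrow> 'v \<Rightarrow> 'v list \<Rightarrow> 'v \<Rightarrow> bool" where
  "path_between adj u xs v \<longleftrightarrow>
     xs \<noteq> [] \<and> hd xs = u \<and> last xs = v \<and> distinct xs \<and> successively adj xs"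

definition tree :: "('v \<Rightarrow> 'v \<Rightarrow> bool) \<Rightarrow> bool" where
  "tree adj \<longleftrightarrow> symp adj \<and> irreflp adj \<and> (\<forall>u v. \<exists>!xs. path_between adj u xs v)"

definition gdist :: "('v \<Rightarrow> 'v \<Rightarrow> bool) \<Rightarrow> 'v \<Rightarrow> 'v \<Rightarrow> nat" where
  "gdist adj u v = (LEAST n. (adj ^^ n) u v)"

definition nbrs :: "('v \<Rightarrow> 'v \<Rightarrow> bool) \<Rightarrow> 'v \<Rightarrow> 'v set" where
  "nbrs adj v = {w. adj v w}"

text \<open>The tree is automatically infinite, since all its vertices have degree at least three.\<close>

definition semihomogeneous_tree ::
    "('v \<Rightarrow> 'v \<Rightarrow> bool) \<Rightarrow> 'v set \<Rightarrow> 'v set \<Rightarrow> nat \<Rightarrow> nat \<Rightarrow> bool" where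
  "semihomogeneous_tree adj Vp Vm qp qm \<longleftrightarrow>
     tree adj \<and> Vp \<union> Vm = UNIV \<and> Vp \<inter> Vm = {} \<and> 2 \<le> qp \<and> 2 \<le> qm \<and>
     (\<forall>v\<in>Vp. card (nbrs adj v) = qp + 1 \<and> nbrs adj v \<subseteq> Vm) \<and>
     (\<forall>v\<in>Vm. card (nbrs adj v) = qm + 1 \<and> nbrs adj v \<subseteq> Vp)"


section \<open>Laplace operator and spherical functions\<close>

definition laplace :: "('v \<Rightarrow> 'v \<Rightarrow> bool) \<Rightarrow> ('v \<Rightarrow> complex) \<Rightarrow> 'v \<Rightarrow> complex" where
  "laplace adj f v = (\<Sum>w\<in>nbrs adj v. f w) / of_nat (card (nbrs adj v))"

definition radial :: "('v \<Rightarrow> 'v \<Rightarrow> bool) \<Rightarrow> 'v \<Rightarrow> ('v \<Rightarrow> complex) \<Rightarrow> bool" where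
  "radial adj v0 f \<longleftrightarrow> (\<forall>u v. gdist adj u v0 = gdist adj v v0 \<longrightarrow> f u = f v)"

definition spherical :: "('v \<Rightarrow> 'v \<Rightarrow> bool) \<Rightarrow> 'v \<Rightarrow> complex \<Rightarrow> 'v \<Rightarrow> complex" where
  "spherical adj v0 \<gamma> =
     (THE \<phi>. radial adj v0 \<phi> \<and> \<phi> v0 = 1 \<and> (\<forall>v. laplace adj \<phi> v = \<gamma> * \<phi> v))"


section \<open>Summability and spectra\<close>

definition lp_space :: "real \<Rightarrow> ('v \<Rightarrow> complex) set" where
  "lp_space p = {f. (\<lambda>v. norm (f v) powr p) summable_on UNIV}"

definition lp_norm :: "real \<Rightarrow> ('v \<Rightarrow> complex) \<Rightarrow> real" where
  "lp_norm p f = (\<Sum>\<^sub>\<infinity>v. norm (f v) powr p) powr (1 / p)"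

definition laplace_minus ::
    "('v \<Rightarrow> 'v \<Rightarrow> bool) \<Rightarrow> complex \<Rightarrow> ('v \<Rightarrow> complex) \<Rightarrow> 'v \<Rightarrow> complex" where
  "laplace_minus adj \<gamma> f = (\<lambda>v. laplace adj f v - \<gamma> * f v)"

text \<open>The spectrum of the Laplace operator on the space \<open>\<ell>\<^sup>2\<close>: the complement of the set of all
  \<open>\<gamma>\<close> for which \<open>\<mu>\<^sub>1 - \<gamma>\<close> is a bijection with bounded inverse.\<close>

definition l2_spectrum :: "('v \<Rightarrow> 'v \<Rightarrow> bool) \<Rightarrow> complex set" where
  "l2_spectrum adj =
     {\<gamma>. \<not> (bij_betw (laplace_minus adj \<gamma>) (lp_space 2) (lp_space 2) \<and>
            (\<exists>C. \<forall>f\<in>lp_space 2. lp_norm 2 f \<le> C * lp_norm 2 (laplace_minus adj \<gamma> f)))}"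

text \<open>The discrete spectrum consists of eigenvalues, and it is taken relative to the reference
  vertex: the eigenfunction in \<open>\<ell>\<^sup>2\<close> is required to be radial around \<open>v0\<close>. The continuous spectrum
  is what remains of the spectrum on the whole of \<open>\<ell>\<^sup>2\<close>. The dependence on \<open>v0\<close> is essential for
  any statement that distinguishes \<open>q\<^sub>+ < q\<^sub>-\<close> from \<open>q\<^sub>+ > q\<^sub>-\<close>: the set of all eigenvalues on
  \<open>\<ell>\<^sup>2\<close> does not change when the two vertex classes are exchanged.\<close>

definition l2_discrete_spectrum :: "('v \<Rightarrow> 'v \<Rightarrow> bool) \<Rightarrow> 'v \<Rightarrow> complex set" where
  "l2_discrete_spectrum adj v0 =
     {\<gamma>. \<exists>f\<in>lp_space 2. radial adj v0 f \<and> f \<noteq> (\<lambda>v. 0) \<and> (\<forall>v. laplace adj f v = \<gamma> * f v)}"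

definition l2_continuous_spectrum :: "('v \<Rightarrow> 'v \<Rightarrow> bool) \<Rightarrow> 'v \<Rightarrow> complex set" where
  "l2_continuous_spectrum adj v0 = l2_spectrum adj - l2_discrete_spectrum adj v0"


section \<open>The function B\<close>

definition qgeo :: "nat \<Rightarrow> nat \<Rightarrow> real" where
  "qgeo qp qm = sqrt (real qp * real qm)"

definition Qf :: "nat \<Rightarrow> nat \<Rightarrow> complex \<Rightarrow> complex" where
  "Qf qp qm \<gamma> = (of_nat qp + 1) * (of_nat qm + 1) * \<gamma>\<^sup>2"

definition Wf :: "nat \<Rightarrow> nat \<Rightarrow> complex \<Rightarrow> complex" where
  "Wf qp qm \<gamma> =
     (Qf qp qm \<gamma>)\<^sup>2 - 2 * (of_nat qp + of_nat qm) * Qf qp qm \<gamma> + (of_nat qp - of_nat qm)\<^sup>2"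

definition cut_a :: "nat \<Rightarrow> nat \<Rightarrow> real" where
  "cut_a qp qm = \<bar>sqrt (real qp) - sqrt (real qm)\<bar> / sqrt ((real qp + 1) * (real qm + 1))"

definition cut_b :: "nat \<Rightarrow> nat \<Rightarrow> real" where
  "cut_b qp qm = (sqrt (real qp) + sqrt (real qm)) / sqrt ((real qp + 1) * (real qm + 1))"

definition cuts :: "nat \<Rightarrow> nat \<Rightarrow> complex set" where
  "cuts qp qm = complex_of_real `
     ({- cut_b qp qm <..< - cut_a qp qm} \<union> {cut_a qp qm <..< cut_b qp qm})"

text \<open>The requirements below determine \<open>R\<close> off the cuts; on the cuts its values are irrelevant.\<close>

definition sqrt_determination :: "nat \<Rightarrow> nat \<Rightarrow> (complex \<Rightarrow> complex) \<Rightarrow> bool" where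
  "sqrt_determination qp qm R \<longleftrightarrow>
     continuous_on (- cuts qp qm) R \<and>
     (\<forall>\<gamma>. \<gamma> \<notin> cuts qp qm \<longrightarrow> (R \<gamma>)\<^sup>2 = Wf qp qm \<gamma>) \<and>
     (\<forall>x. x > cut_b qp qm \<longrightarrow> (\<exists>r>0. R (complex_of_real x) = complex_of_real r))"

lemma sqrt_determination_exists:
  assumes "2 \<le> qp" "2 \<le> qm"
  shows "\<exists>R. sqrt_determination qp qm R"
proof -
  define s where "s = real qp + real qm"
  define c where "c = (real qp + 1) * (real qm + 1)"
  define k where "k = 4 * (real qp * real qm)"
  define u where "u = (\<lambda>\<gamma>. complex_of_real c * \<gamma>\<^sup>2 - complex_of_real s)"
  define z where "z = (\<lambda>\<gamma>. 1 - complex_of_real k / (u \<gamma>)\<^sup>2)"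
  define R where "R = (\<lambda>\<gamma>. u \<gamma> * csqrt (z \<gamma>))"
  have c: "c > 0" and k: "k > 0" and s: "s > 0"
    using assms by (auto simp: c_def k_def s_def intro!: mult_pos_pos add_pos_pos)
  have uQ: "Qf qp qm \<gamma> = u \<gamma> + complex_of_real s" for \<gamma>
    by (simp add: Qf_def u_def c_def s_def)
  have Wu: "Wf qp qm \<gamma> = (u \<gamma>)\<^sup>2 - complex_of_real k" for \<gamma>
    unfolding Wf_def uQ k_def s_def by (simp add: power2_eq_square algebra_simps)
  have sq_a: "(sqrt (real qp) - sqrt (real qm))\<^sup>2 = s - sqrt k"
    and sq_b: "(sqrt (real qp) + sqrt (real qm))\<^sup>2 = s + sqrt k"
    by (simp_all add: power2_diff power2_sum s_def k_def real_sqrt_mult)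
  have a2: "(cut_a qp qm)\<^sup>2 = (s - sqrt k) / c" and b2: "(cut_b qp qm)\<^sup>2 = (s + sqrt k) / c"
    using c sq_a sq_b by (simp_all add: cut_a_def cut_b_def power_divide flip: c_def)
  have a0: "cut_a qp qm \<ge> 0" and b0: "cut_b qp qm > 0"
    using c assms by (auto simp: cut_a_def cut_b_def simp flip: c_def intro!: divide_pos_pos add_pos_pos)
  have in_cuts: "\<gamma> \<in> cuts qp qm"
    if "complex_of_real t = u \<gamma>" "t\<^sup>2 < k" for \<gamma> t
  proof -
    have t: "\<bar>t\<bar> < sqrt k" using that(2) real_less_rsqrt[of "\<bar>t\<bar>" k] by simp
    define g where "g = (t + s) / c"
    have "s \<ge> sqrt k" using sq_a by (metis diff_ge_0_iff_ge zero_le_power2)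
    then have g: "g > 0" using t c by (simp add: g_def)
    have "\<gamma>\<^sup>2 = complex_of_real g"
      using that(1) c by (simp add: u_def g_def field_simps)
    also have "\<dots> = (complex_of_real (sqrt g))\<^sup>2" using g by (simp flip: of_real_power)
    finally have \<gamma>: "\<gamma> = complex_of_real (sqrt g) \<or> \<gamma> = complex_of_real (- sqrt g)"
      by (simp add: power2_eq_iff)
    have "(cut_a qp qm)\<^sup>2 < (sqrt g)\<^sup>2" "(sqrt g)\<^sup>2 < (cut_b qp qm)\<^sup>2"
      using t c g unfolding a2 b2 by (simp_all add: g_def divide_strict_right_mono)
    then have "cut_a qp qm < sqrt g" "sqrt g < cut_b qp qm"
      using a0 b0 g by (auto intro: power2_less_imp_less)
    then have "sqrt g \<in> {cut_a qp qm <..< cut_b qp qm}"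
      "- sqrt g \<in> {- cut_b qp qm <..< - cut_a qp qm}" by auto
    then show ?thesis using \<gamma> unfolding cuts_def by blast
  qed
  have u0: "u \<gamma> \<noteq> 0" if "\<gamma> \<notin> cuts qp qm" for \<gamma>
    using in_cuts[of 0 \<gamma>] that k by auto
  have zS: "z \<gamma> \<notin> \<real>\<^sub>\<le>\<^sub>0 \<or> z \<gamma> = 0" if \<gamma>: "\<gamma> \<notin> cuts qp qm" for \<gamma>
  proof (rule ccontr)
    assume "\<not> ?thesis"
    then obtain r where r: "z \<gamma> = complex_of_real r" "r < 0"
      by (force elim!: nonpos_Reals_cases)
    define h where "h = k / (1 - r)"
    have h: "0 < h" "h < k" using r k by (auto simp: h_def field_simps mult_pos_neg)
    have "complex_of_real k / (u \<gamma>)\<^sup>2 = complex_of_real (1 - r)"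
      using r by (simp add: z_def algebra_simps)
    then have "(u \<gamma>)\<^sup>2 = complex_of_real h"
      using u0[OF \<gamma>] r by (simp add: h_def field_simps)
    also have "\<dots> = (complex_of_real (sqrt h))\<^sup>2" using h by (simp flip: of_real_power)
    finally have "complex_of_real (sqrt h) = u \<gamma> \<or> complex_of_real (- sqrt h) = u \<gamma>"
      by (auto simp: power2_eq_iff)
    then show False using in_cuts[of "sqrt h" \<gamma>] in_cuts[of "- sqrt h" \<gamma>] h \<gamma> by auto
  qed
  have "isCont csqrt w \<or> w = 0" if "w \<notin> \<real>\<^sub>\<le>\<^sub>0 \<or> w = 0" for w
    using that continuous_at_csqrt by blast
  moreover have "isCont csqrt 0"
  proof -
    have "((\<lambda>w. norm (csqrt w)) \<longlongrightarrow> sqrt (norm (0::complex))) (at 0)"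
      unfolding norm_csqrt by (intro tendsto_intros)
    then have "(csqrt \<longlongrightarrow> 0) (at 0)"
      using tendsto_norm_zero_cancel[of csqrt "at 0"] by simp
    then show ?thesis by (simp add: isCont_def)
  qed
  ultimately have csq: "isCont csqrt w" if "w \<notin> \<real>\<^sub>\<le>\<^sub>0 \<or> w = 0" for w
    using that by blast
  have "continuous_on (- cuts qp qm) z"
    unfolding z_def using u0 by (auto simp: u_def intro!: continuous_intros)
  moreover have "continuous_on (z ` (- cuts qp qm)) csqrt"
    using csq zS by (intro continuous_at_imp_continuous_on) auto
  ultimately have "continuous_on (- cuts qp qm) (\<lambda>\<gamma>. csqrt (z \<gamma>))"
    using continuous_on_compose[of "- cuts qp qm" z csqrt] by (simp add: o_def)
  then have 1: "continuous_on (- cuts qp qm) R"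
    unfolding R_def u_def by (intro continuous_intros)
  have 2: "(R \<gamma>)\<^sup>2 = Wf qp qm \<gamma>" if "\<gamma> \<notin> cuts qp qm" for \<gamma>
  proof -
    have "(R \<gamma>)\<^sup>2 = (u \<gamma>)\<^sup>2 * z \<gamma>" by (simp add: R_def power_mult_distrib)
    also have "\<dots> = Wf qp qm \<gamma>"
      unfolding Wu z_def right_diff_distrib using u0[OF that] by simp
    finally show ?thesis .
  qed
  have 3: "\<exists>r>0. R (complex_of_real x) = complex_of_real r" if x: "x > cut_b qp qm" for x
  proof -
    have "(cut_b qp qm)\<^sup>2 < x\<^sup>2" using x b0 by (intro power_strict_mono) auto
    then have v: "sqrt k < c * x\<^sup>2 - s" using c unfolding b2 by (simp add: field_simps)
    define v' where "v' = c * x\<^sup>2 - s"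
    have v'0: "v' > 0" using v real_sqrt_gt_zero[OF k] unfolding v'_def by linarith
    have "(sqrt k)\<^sup>2 < v'\<^sup>2"
      using v k by (intro power_strict_mono) (auto simp: v'_def)
    then have "k < v'\<^sup>2" using k by simp
    then have y: "1 - k / v'\<^sup>2 > 0" using v'0 by (simp add: field_simps)
    have u: "u (complex_of_real x) = complex_of_real v'" by (simp add: u_def v'_def)
    have zx: "z (complex_of_real x) = complex_of_real (1 - k / v'\<^sup>2)" by (simp add: z_def u)
    have "R (complex_of_real x) = complex_of_real (v' * sqrt (1 - k / v'\<^sup>2))"
      unfolding R_def u zx of_real_mult using of_real_sqrt[OF less_imp_le[OF y]] by metis
    then show ?thesis using v'0 y by (blast intro: mult_pos_pos real_sqrt_gt_zero)
  qed
  from 1 2 3 show ?thesis unfolding sqrt_determination_def by blast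
qed

definition Bf :: "nat \<Rightarrow> nat \<Rightarrow> (complex \<Rightarrow> complex) \<Rightarrow> complex \<Rightarrow> complex" where
  "Bf qp qm R \<gamma> =
     (Qf qp qm \<gamma> - (of_nat qp + of_nat qm) - R \<gamma>) / (2 * complex_of_real (qgeo qp qm))"

definition B_abs :: "nat \<Rightarrow> nat \<Rightarrow> (complex \<Rightarrow> complex) \<Rightarrow> complex \<Rightarrow> real" where
  "B_abs qp qm R \<gamma> = (if \<gamma> \<in> cuts qp qm then 1 else cmod (Bf qp qm R \<gamma>))"

definition p_crit :: "nat \<Rightarrow> nat \<Rightarrow> real" where
  "p_crit qp qm = ln (real qp * real qm) / ln (real qm)"

end

(* The values of a radial eigenfunction on the even spheres satisfy a linear recurrence with
   constant coefficients whose characteristic roots s, t have moduli |B| / q and 1 / (|B| q) in some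
   order, where q = sqrt (qp qm). Since the sphere of radius 2 k has about q^(2 k) vertices,
   membership in l^p and boundedness are read off the growth of the solution, which is governed by
   the larger root s unless the solution is proportional to t^k. That happens only for the
   eigenvalue 0, whose spherical function is (-1 / qm)^k at distance 2 k and vanishes at odd
   distances. Everything is symmetric in s and t, so the choice of the branch R is irrelevant. For
   qp > qm, the value 0 is in the spectrum because the spherical function around a vertex of Vm is
   an eigenfunction in l^2. *)

theory Submission
  imports Defs
begin

section \<open>Distances in trees\<close>

text \<open>The branching number alternates from level to level, so the one-step recurrence has
  alternating coefficients; they become constant only once the odd levels are eliminated. The roots
  \<open>s\<close> and \<open>t\<close> may coincide, hence no closed form with denominator
  \<open>s - t\<close> is available. Instead, \<open>e (Suc k) - t * e k\<close> is exactly
  geometric with ratio \<open>s\<close>, which yields both the upper bounds and the necessary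
  conditions. The initial values enter only through \<open>e 1 \<noteq> t * e 0\<close>: inserting
  \<open>e 1 = t\<close> into the characteristic equation turns it into
  \<open>(qm + 1) * \<gamma>\<^sup>2 * (1 - t) = 0\<close>, and \<open>norm t < 1\<close> because
  \<open>s * t = 1 / (qp * qm)\<close>. The larger of |B| and 1/|B| is z = q |s|, so the conditions
  on |B| that are invariant under inversion become upper bounds for z. At the eigenvalue 0 the roots
  are -1/qp and -1/qm, and the solution follows -1/qm whichever of the two is larger. This is why
  only the order of \<open>qp\<close> and \<open>qm\<close> matters there, and the critical exponent
  solves qp qm = qm^p.\<close>

lemma successively_append_Cons:
  "successively P (xs @ y # ys) \<longleftrightarrow>
     successively P (xs @ [y]) \<and> successively P (y # ys)"
  by (cases ys) (auto simp: successively_append_iff)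

text \<open>If \<open>w\<close> is off the path to \<open>v\<close>, appending it gives a path to
  \<open>w\<close>. Otherwise the path to \<open>v\<close> can be cut at \<open>w\<close>, and
  appending \<open>v\<close> to the piece gives a path to \<open>v\<close> again. Uniqueness of
  paths settles both cases.\<close>

lemma tree_path_step:
  assumes tree: "tree adj" and vw: "adj v w"
    and xs: "path_between adj r xs v" and ys: "path_between adj r ys w"
  shows "ys = xs @ [w] \<or> xs = ys @ [v]"
proof -
  have uniq: "\<exists>!zs. path_between adj r zs u" for u
    using tree by (simp add: tree_def)
  have wv: "adj w v" and ne: "v \<noteq> w"
    using tree vw by (auto simp: tree_def dest: sympD irreflpD)
  show ?thesis
  proof (cases "w \<in> set xs")
    case False
    then have "path_between adj r (xs @ [w]) w"
      using xs vw by (auto simp: path_between_def successively_append_iff)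
    then show ?thesis using uniq ys by blast
  next
    case True
    then obtain as bs where xs_eq: "xs = as @ w # bs" by (meson split_list)
    have "path_between adj r (as @ [w]) w"
      using xs unfolding path_between_def xs_eq
      by (subst (asm) successively_append_Cons) (auto simp: hd_append)
    then have ys_eq: "ys = as @ [w]" using uniq ys by blast
    \<comment> \<open>\<open>v\<close> is the last entry and differs from \<open>w\<close>, so it
      lies in \<open>bs\<close>; distinctness keeps it out of the initial piece.\<close>
    have "v \<notin> set (as @ [w])"
      using xs ne unfolding path_between_def xs_eq by (cases bs rule: rev_cases) auto
    then have "path_between adj r (ys @ [v]) v"
      using ys wv unfolding ys_eq
      by (auto simp: path_between_def successively_append_iff hd_append)
    then show ?thesis using uniq xs by blast
  qed
qed

text \<open>The depth is the number of edges of the unique path from \<open>r\<close>. It is built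
  from paths, while \<open>gdist\<close> is defined by walks; the three properties listed are enough
  to identify the two.\<close>

lemma tree_depth:
  assumes tree: "tree adj"
  shows "\<exists>d :: 'v \<Rightarrow> nat. (\<forall>v. d v = 0 \<longleftrightarrow> v = r) \<and>
    (\<forall>v w. adj v w \<longrightarrow> d w = Suc (d v) \<or> d v = Suc (d w)) \<and>
    (\<forall>v n. d v = Suc n \<longrightarrow> (\<exists>!u. adj v u \<and> d u = n))"
proof -
  have "\<forall>v. \<exists>xs. path_between adj r xs v" using tree by (meson ex1_implies_ex tree_def)
  then obtain P where P: "\<And>v. path_between adj r (P v) v" by metis
  have P_uniq: "xs = P v" if "path_between adj r xs v" for xs v
    using tree that P[of v] unfolding tree_def by blast
  have sym: "adj v u" if "adj u v" for u v using tree that by (auto simp: tree_def dest: sympD)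
  have ne: "P v \<noteq> []" for v using P by (auto simp: path_between_def)
  have step: "P w = P v @ [w] \<or> P v = P w @ [v]" if "adj v w" for v w
    using tree_path_step[OF tree that P P] .
  define d where "d = (\<lambda>v. length (P v) - 1)"
  have len: "length (P v) = Suc (d v)" for v using ne[of v] by (simp add: d_def)
  have Pr: "P r = [r]" by (rule P_uniq[symmetric]) (simp add: path_between_def)
  show ?thesis
  proof (intro exI[of _ d] conjI allI impI)
    show "d v = 0 \<longleftrightarrow> v = r" for v
    proof
      assume "d v = 0"
      then have "length (P v) = 1" using len by simp
      then show "v = r" using P[of v] by (auto simp: length_Suc_conv path_between_def)
    qed (simp add: d_def Pr)
    show "d w = Suc (d v) \<or> d v = Suc (d w)" if "adj v w" for v w
      using step[OF that] len[of v] len[of w] by auto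
    show "\<exists>!u. adj v u \<and> d u = n" if n: "d v = Suc n" for v n
    proof
      have two: "length (P v) = Suc (Suc n)" using n len by simp
      obtain bs y where "P v = bs @ [y]" using ne[of v] by (cases "P v" rule: rev_cases) auto
      moreover from this two obtain as x where "bs = as @ [x]" by (cases bs rule: rev_cases) auto
      ultimately have xy: "P v = as @ [x, y]" by simp
      have "path_between adj r (as @ [x]) x" and "adj x y" and "y = v"
        using P[of v] unfolding path_between_def xy
        by (auto simp: successively_append_iff hd_append)
      \<comment> \<open>The parent is the last but one vertex on the path from \<open>r\<close> to
        \<open>v\<close>.\<close>
      then show "adj v (last (butlast (P v))) \<and> d (last (butlast (P v))) = n"
        using P_uniq[of "as @ [x]" x, symmetric] two sym by (simp add: d_def butlast_append xy)
      show "u = last (butlast (P v))" if "adj v u \<and> d u = n" for u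
      proof -
        have "P v = P u @ [v]"
          using step[of v u] that n len[of u] len[of v] by auto
        then show ?thesis using P[of u] by (simp add: path_between_def)
      qed
    qed
  qed
qed

text \<open>Descending through parents gives a walk of length \<open>d v\<close> to
  \<open>r\<close>. Along any edge the depth changes by exactly one, so no walk to \<open>r\<close>
  is shorter; hence \<open>gdist\<close> is the depth and inherits its properties.\<close>

lemma tree_gdist:
  assumes tree: "tree adj"
  shows gdist_eq_0_iff: "gdist adj v r = 0 \<longleftrightarrow> v = r"
    and gdist_adj: "adj v w \<Longrightarrow>
      gdist adj w r = Suc (gdist adj v r) \<or> gdist adj v r = Suc (gdist adj w r)"
    and gdist_parent: "gdist adj v r = Suc n \<Longrightarrow> \<exists>!u. adj v u \<and> gdist adj u r = n"
proof -
  obtain d :: "'a \<Rightarrow> nat" where d0: "\<forall>v. d v = 0 \<longleftrightarrow> v = r"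
    and d1: "\<forall>v w. adj v w \<longrightarrow> d w = Suc (d v) \<or> d v = Suc (d w)"
    and d2: "\<forall>v n. d v = Suc n \<longrightarrow> (\<exists>!u. adj v u \<and> d u = n)"
    using tree_depth[OF tree, of r] by blast
  have walk: "(adj ^^ d v) v r" for v
  proof (induction "d v" arbitrary: v)
    case 0
    then show ?case using d0 by (metis relpowp_0_I)
  next
    case (Suc n)
    then obtain u where "adj v u" "d u = n" using d2 by metis
    then show ?case using Suc by (metis relpowp_Suc_I2)
  qed
  have "d v \<le> n" if "(adj ^^ n) v r" for v n
    using that
  proof (induction n arbitrary: v)
    case 0
    then show ?case using d0 by simp
  next
    case (Suc n)
    then obtain u where "adj v u" "d u \<le> n" by (meson relpowp_Suc_D2)
    then show ?case using d1 by fastforce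
  qed
  then have "gdist adj v r = d v" for v
    unfolding gdist_def using walk by (intro Least_equality) auto
  then show "gdist adj v r = 0 \<longleftrightarrow> v = r"
    "adj v w \<Longrightarrow> gdist adj w r = Suc (gdist adj v r) \<or> gdist adj v r = Suc (gdist adj w r)"
    "gdist adj v r = Suc n \<Longrightarrow> \<exists>!u. adj v u \<and> gdist adj u r = n"
    using d0 d1 d2 by auto
qed

section \<open>Radial eigenfunctions\<close>

lemma of_nat_plus_1_neq_0: "of_nat n + (1::complex) \<noteq> 0" "1 + of_nat n \<noteq> (0::complex)"
  by (metis of_nat_Suc of_nat_neq_0 add.commute)+

text \<open>The value on the sphere of radius \<open>n\<close>, obtained by solving the eigenvalue
  equation outwards. The equation that produces level \<open>n + 2\<close> is the one at level
  \<open>n + 1\<close>, so an even \<open>n\<close> brings in the branching number \<open>qm\<close>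
  of the odd level.\<close>

fun radial_eigen :: "nat \<Rightarrow> nat \<Rightarrow> complex \<Rightarrow> nat \<Rightarrow> complex" where
  "radial_eigen qp qm \<gamma> 0 = 1"
| "radial_eigen qp qm \<gamma> (Suc 0) = \<gamma>"
| "radial_eigen qp qm \<gamma> (Suc (Suc n)) =
     (let q = of_nat (if even n then qm else qp)
      in ((q + 1) * \<gamma> * radial_eigen qp qm \<gamma> (Suc n) - radial_eigen qp qm \<gamma> n) / q)"

text \<open>Both vertex classes are parameters, so that the locale can be interpreted a second time
  with the classes exchanged and the root in the other class.\<close>

locale rooted_semihomogeneous_tree =
  fixes adj :: "'v \<Rightarrow> 'v \<Rightarrow> bool" and Vp Vm :: "'v set" and qp qm :: nat and v0 :: 'v
  assumes semihomogeneous: "semihomogeneous_tree adj Vp Vm qp qm"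
    and root: "v0 \<in> Vp"
begin

abbreviation lev :: "'v \<Rightarrow> nat" where
  "lev v \<equiv> gdist adj v v0"

definition branching :: "nat \<Rightarrow> nat" where
  "branching n = (if even n then qp else qm)"

definition children :: "'v \<Rightarrow> 'v set" where
  "children v = {w. adj v w \<and> lev w = Suc (lev v)}"

lemma tree: "tree adj" and qp_ge: "qp \<ge> 2" and qm_ge: "qm \<ge> 2"
  using semihomogeneous by (auto simp: semihomogeneous_tree_def)

lemma adj_sym: "adj v w \<Longrightarrow> adj w v"
  using tree by (auto simp: tree_def dest: sympD)

lemma lev_eq_0_iff [simp]: "lev v = 0 \<longleftrightarrow> v = v0"
  by (rule gdist_eq_0_iff[OF tree])

lemma lev_root [simp]: "lev v0 = 0"
  by simp

lemma Vp_iff_even_lev: "v \<in> Vp \<longleftrightarrow> even (lev v)"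
proof (induction "lev v" arbitrary: v)
  case 0
  then have "v = v0" using lev_eq_0_iff by metis
  then show ?case using root by simp
next
  case (Suc n)
  then obtain u where u: "adj v u" "lev u = n" using gdist_parent[OF tree, of v v0 n] by auto
  have "v \<in> Vp \<longleftrightarrow> u \<notin> Vp"
    using semihomogeneous u(1) unfolding semihomogeneous_tree_def nbrs_def by blast
  then show ?case using Suc.hyps(1)[of u] u(2) Suc.hyps(2) by (metis even_Suc)
qed

lemma card_nbrs: "card (nbrs adj v) = Suc (branching (lev v))"
proof -
  have "v \<in> Vp \<or> v \<in> Vm" using semihomogeneous by (auto simp: semihomogeneous_tree_def)
  moreover have "\<not> (v \<in> Vp \<and> v \<in> Vm)"
    using semihomogeneous by (auto simp: semihomogeneous_tree_def)
  ultimately show ?thesis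
    using semihomogeneous Vp_iff_even_lev[of v]
    unfolding semihomogeneous_tree_def branching_def by auto
qed

lemma finite_nbrs: "finite (nbrs adj v)"
  using card_nbrs[of v] by (metis card.infinite nat.distinct(1))

lemma branching_pos: "branching n > 0"
  using qp_ge qm_ge by (simp add: branching_def)

lemma finite_children: "finite (children v)"
  by (rule finite_subset[OF _ finite_nbrs[of v]]) (auto simp: children_def nbrs_def)

lemma nbrs_root: "nbrs adj v0 = children v0"
  using gdist_adj[OF tree, of v0 _ v0] by (auto simp: children_def nbrs_def)

lemma nbrs_non_root:
  assumes "lev v = Suc n"
  obtains u where "adj v u" "lev u = n" "u \<notin> children v" "nbrs adj v = insert u (children v)"
proof -
  from gdist_parent[OF tree assms] obtain u
    where u: "adj v u" "lev u = n" and uniq: "\<And>w. adj v w \<Longrightarrow> lev w = n \<Longrightarrow> w = u" by auto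
  have "nbrs adj v = insert u (children v)"
  proof (intro equalityI subsetI)
    fix w assume "w \<in> nbrs adj v"
    then show "w \<in> insert u (children v)"
      using gdist_adj[OF tree, of v w v0] uniq[of w] assms by (auto simp: children_def nbrs_def)
  qed (use u in \<open>auto simp: children_def nbrs_def\<close>)
  moreover have "u \<notin> children v" using u assms by (auto simp: children_def)
  ultimately show thesis using u that by blast
qed

lemma card_children:
  "card (children v) = (if v = v0 then Suc qp else branching (lev v))"
proof (cases "lev v")
  case 0
  then show ?thesis using nbrs_root card_nbrs[of v0] by (simp add: branching_def)
next
  case (Suc n)
  then obtain u where "u \<notin> children v" "nbrs adj v = insert u (children v)"
    by (rule nbrs_non_root)
  then show ?thesis using card_nbrs[of v] finite_children[of v] Suc by auto
qed

section \<open>Growth of the spheres\<close>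

definition sphere_size :: "nat \<Rightarrow> nat" where
  "sphere_size n = card {v. lev v = n}"

lemma sphere_Suc: "{v. lev v = Suc n} = (\<Union>u\<in>{u. lev u = n}. children u)"
proof (intro equalityI subsetI)
  fix v assume "v \<in> {v. lev v = Suc n}"
  then have "lev v = Suc n" by simp
  then obtain u where "adj v u" "lev u = n" by (rule nbrs_non_root)
  then show "v \<in> (\<Union>u\<in>{u. lev u = n}. children u)"
    using \<open>lev v = Suc n\<close> adj_sym by (auto simp: children_def)
qed (auto simp: children_def)

lemma finite_sphere: "finite {v. lev v = n}"
proof (induction n)
  case (Suc n)
  then show ?case unfolding sphere_Suc using finite_children by simp
qed simp

lemma sphere_size_0: "sphere_size 0 = 1"
  by (simp add: sphere_size_def)

lemma sphere_size_Suc: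
  "sphere_size (Suc n) = (if n = 0 then Suc qp else branching n * sphere_size n)"
proof -
  \<comment> \<open>Uniqueness of the parent makes the sets of children disjoint, so their
    cardinalities add up.\<close>
  have "u = u'" if "v \<in> children u" "v \<in> children u'" for u u' v
    using gdist_parent[OF tree, of v v0 "lev u"] that adj_sym by (auto simp: children_def)
  then have "sphere_size (Suc n) = (\<Sum>u\<in>{u. lev u = n}. card (children u))"
    unfolding sphere_size_def sphere_Suc
    by (intro card_UN_disjoint) (auto simp: finite_sphere finite_children)
  also have "\<dots> = (\<Sum>u\<in>{u. lev u = n}. if n = 0 then Suc qp else branching n)"
    by (intro sum.cong) (auto simp: card_children)
  finally show ?thesis by (simp add: sphere_size_def)
qed

lemma sphere_size_even_Suc:
  "sphere_size (2 * Suc k) = (if k = 0 then Suc qp * qm else qp * qm * sphere_size (2 * k))"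
  by (simp add: sphere_size_Suc branching_def)

lemma sphere_size_even_ge: "(qp * qm) ^ k \<le> sphere_size (2 * k)"
proof (induction k)
  case (Suc k)
  then show ?case unfolding sphere_size_even_Suc by (auto simp: sphere_size_0)
qed (simp add: sphere_size_0)

text \<open>The root has one child more than the other vertices of its class. This costs the factor
  \<open>(qp + 1) / qp\<close> once, and 2 is a bound for it.\<close>

lemma sphere_size_even_le: "sphere_size (2 * k) \<le> 2 * (qp * qm) ^ k"
proof (induction k)
  case (Suc k)
  then show ?case unfolding sphere_size_even_Suc using qp_ge by (auto simp: sphere_size_0)
qed (simp add: sphere_size_0)

lemma sphere_size_odd_le: "sphere_size (Suc (2 * k)) \<le> 2 * Suc qp * (qp * qm) ^ k"
proof -
  have "sphere_size (Suc (2 * k)) \<le> Suc qp * sphere_size (2 * k)"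
    by (simp add: sphere_size_Suc branching_def sphere_size_0)
  also have "\<dots> \<le> Suc qp * (2 * (qp * qm) ^ k)"
    using sphere_size_even_le by (rule mult_le_mono2)
  finally show ?thesis by (simp add: algebra_simps)
qed

lemma sphere_nonempty: "\<exists>v. lev v = n"
proof -
  have "sphere_size n > 0"
    using branching_pos by (induction n) (auto simp: sphere_size_0 sphere_size_Suc)
  then show ?thesis unfolding sphere_size_def by (auto simp: card_gt_0_iff)
qed

section \<open>The Laplace operator on radial functions, and summation over spheres\<close>

lemma laplace_of_radial:
  "laplace adj (\<lambda>v. g (lev v)) v =
     (case lev v of 0 \<Rightarrow> g 1
      | Suc n \<Rightarrow> (g n + of_nat (branching (Suc n)) * g (Suc (Suc n))) / (of_nat (branching (Suc n)) + 1))"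
proof (cases "lev v")
  case 0
  then have [simp]: "v = v0" by simp
  have "(\<Sum>w\<in>nbrs adj v0. g (lev w)) = of_nat (card (nbrs adj v0)) * g 1"
    unfolding nbrs_root by (simp add: children_def)
  then show ?thesis by (simp add: laplace_def card_nbrs of_nat_plus_1_neq_0)
next
  case (Suc n)
  then obtain u where u: "lev u = n" "u \<notin> children v" "nbrs adj v = insert u (children v)"
    by (rule nbrs_non_root)
  have "(\<Sum>w\<in>children v. g (lev w)) = of_nat (card (children v)) * g (Suc (Suc n))"
    using Suc by (simp add: children_def)
  moreover have "v \<noteq> v0" using Suc by auto
  ultimately have "(\<Sum>w\<in>nbrs adj v. g (lev w)) = g n + of_nat (branching (Suc n)) * g (Suc (Suc n))"
    using u finite_children Suc by (simp add: card_children)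
  then show ?thesis using Suc by (simp add: laplace_def card_nbrs add.commute)
qed

lemma radial_iff: "radial adj v0 f \<longleftrightarrow> (\<exists>g. f = (\<lambda>v. g (lev v)))"
proof
  assume f: "radial adj v0 f"
  define g where "g n = f (SOME v. lev v = n)" for n
  have "lev (SOME u. lev u = lev v) = lev v" for v by (rule someI) simp
  then have "f v = g (lev v)" for v
    using f unfolding g_def radial_def by metis
  then show "\<exists>g. f = (\<lambda>v. g (lev v))" by blast
qed (auto simp: radial_def)

lemma radial_eigen_laplace:
  "laplace adj (\<lambda>v. radial_eigen qp qm \<gamma> (lev v)) v = \<gamma> * radial_eigen qp qm \<gamma> (lev v)"
proof -
  have "qp \<noteq> 0" "qm \<noteq> 0" using qp_ge qm_ge by auto
  then show ?thesis
    unfolding laplace_of_radial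
    by (auto split: nat.split simp: branching_def Let_def of_nat_plus_1_neq_0)
qed

text \<open>No sphere is empty, so the pointwise equation gives one scalar equation for each level.
  The branching number there is nonzero, hence the equation determines the next value, and
  everything is fixed by the value at the root.\<close>

lemma radial_eigenfunction:
  assumes "radial adj v0 f" "\<And>v. laplace adj f v = \<gamma> * f v"
  shows "f v = f v0 * radial_eigen qp qm \<gamma> (lev v)"
proof -
  obtain g where g: "f = (\<lambda>v. g (lev v))" using assms(1) radial_iff by blast
  have nz: "(of_nat (branching n) :: complex) \<noteq> 0" for n
    using branching_pos[of n] by simp
  have lap: "(case n of 0 \<Rightarrow> g 1
      | Suc m \<Rightarrow> (g m + of_nat (branching (Suc m)) * g (Suc (Suc m))) / (of_nat (branching (Suc m)) + 1))
      = \<gamma> * g n" for n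
  proof -
    obtain w where "lev w = n" using sphere_nonempty by blast
    then show ?thesis using assms(2)[of w] unfolding g laplace_of_radial by simp
  qed
  have "g n = g 0 * radial_eigen qp qm \<gamma> n" for n
  proof (induction n rule: less_induct)
    case (less n)
    consider "n = 0" | "n = Suc 0" | m where "n = Suc (Suc m)" by (metis not0_implies_Suc)
    then show ?case
    proof cases
      case 2
      then show ?thesis using lap[of 0] by simp
    next
      case 3
      define q where "q = (of_nat (branching (Suc m)) :: complex)"
      have "(g m + q * g n) = (q + 1) * \<gamma> * g (Suc m)"
        using lap[of "Suc m"] of_nat_plus_1_neq_0[of "branching (Suc m)"]
        by (simp add: 3 field_simps flip: q_def)
      then have "g n = ((q + 1) * \<gamma> * g (Suc m) - g m) / q"
        using nz[of "Suc m"] by (simp add: field_simps flip: q_def)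
      moreover have "g m = g 0 * radial_eigen qp qm \<gamma> m"
        "g (Suc m) = g 0 * radial_eigen qp qm \<gamma> (Suc m)" using less.IH[of m] less.IH[of "Suc m"] 3 by simp_all
      moreover have "radial_eigen qp qm \<gamma> n =
        ((q + 1) * \<gamma> * radial_eigen qp qm \<gamma> (Suc m) - radial_eigen qp qm \<gamma> m) / q"
        by (simp add: 3 q_def branching_def Let_def)
      ultimately show ?thesis
        by (simp only: times_divide_eq_right right_diff_distrib mult_ac)
    qed simp
  qed
  from this[of "lev v"] show ?thesis by (simp add: g)
qed

text \<open>Existence and uniqueness together justify the definite description; from here on only
  the scalar sequence matters.\<close>

lemma spherical_eq: "spherical adj v0 \<gamma> = (\<lambda>v. radial_eigen qp qm \<gamma> (lev v))"
  unfolding spherical_def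
proof (rule the_equality)
  show "\<phi> = (\<lambda>v. radial_eigen qp qm \<gamma> (lev v))"
    if "radial adj v0 \<phi> \<and> \<phi> v0 = 1 \<and> (\<forall>v. laplace adj \<phi> v = \<gamma> * \<phi> v)" for \<phi>
    using that radial_eigenfunction[of \<phi> \<gamma>] by auto
qed (auto simp: radial_eigen_laplace radial_def)

text \<open>The unordered sum is regrouped along the finite spheres. Nonnegativity makes the
  regrouping an equivalence and turns unordered summability over the levels into convergence of a
  series.\<close>

lemma summable_on_lev_iff:
  fixes g :: "nat \<Rightarrow> real"
  assumes "\<And>n. g n \<ge> 0"
  shows "(\<lambda>v. g (lev v)) summable_on UNIV \<longleftrightarrow> summable (\<lambda>n. of_nat (sphere_size n) * g n)"
proof -
  let ?S = "\<lambda>n. {v. lev v = n}"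
  have hs: "((\<lambda>v. g (lev v)) has_sum of_nat (sphere_size n) * g n) (?S n)" for n
    using has_sum_finite[OF finite_sphere, of "\<lambda>v. g (lev v)" n] by (simp add: sphere_size_def)
  have "bij_betw (\<lambda>v. (lev v, v)) UNIV (Sigma UNIV ?S)"
    by (rule bij_betwI[where g = snd]) auto
  from summable_on_reindex_bij_betw[OF this, of "\<lambda>(n, v). g (lev v)"]
  have "(\<lambda>v. g (lev v)) summable_on UNIV \<longleftrightarrow> (\<lambda>(n, v). g (lev v)) summable_on Sigma UNIV ?S"
    by simp
  also have "\<dots> \<longleftrightarrow> (\<lambda>n. of_nat (sphere_size n) * g n) summable_on UNIV"
  proof
    assume "(\<lambda>(n, v). g (lev v)) summable_on Sigma UNIV ?S"
    from summable_on_Sigma_banach[OF this]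
    show "(\<lambda>n. of_nat (sphere_size n) * g n) summable_on UNIV"
      using infsumI[OF hs] by simp
  next
    assume "(\<lambda>n. of_nat (sphere_size n) * g n) summable_on UNIV"
    with hs show "(\<lambda>(n, v). g (lev v)) summable_on Sigma UNIV ?S"
      by (intro summable_on_SigmaI) (auto simp: assms)
  qed
  also have "\<dots> \<longleftrightarrow> summable (\<lambda>n. of_nat (sphere_size n) * g n)"
    by (rule summable_on_UNIV_nonneg_real_iff) (simp add: assms)
  finally show ?thesis .
qed

end

section \<open>The recurrence on even spheres\<close>

text \<open>The second-order difference operator factors into two first-order ones with ratios
  \<open>s\<close> and \<open>t\<close>. Applying only the factor of \<open>t\<close> leaves a pure
  geometric sequence, including when \<open>s = t\<close>.\<close>

lemma linear_recurrence_factor: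
  fixes e :: "nat \<Rightarrow> complex"
  assumes "\<And>k. e (Suc (Suc k)) = (s + t) * e (Suc k) - s * t * e k"
  shows "e (Suc k) - t * e k = s ^ k * (e 1 - t * e 0)"
proof (induction k)
  case (Suc k)
  have "e (Suc (Suc k)) - t * e (Suc k) = s * (e (Suc k) - t * e k)"
    unfolding assms by (simp add: algebra_simps)
  then show ?case using Suc by simp
qed simp

text \<open>The sequence solves a first-order recurrence with contraction \<open>t\<close> and
  forcing term of size at most \<open>\<rho> ^ k\<close>; the gap between \<open>norm t\<close> and
  \<open>\<rho>\<close> absorbs the forcing. Equality is allowed for \<open>s\<close>, because
  boundedness will need \<open>norm s = \<rho> = 1\<close>.\<close>

lemma linear_recurrence_bound:
  fixes e :: "nat \<Rightarrow> complex"
  assumes rec: "\<And>k. e (Suc (Suc k)) = (s + t) * e (Suc k) - s * t * e k"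
    and s: "norm s \<le> \<rho>" and t: "norm t < \<rho>"
  shows "\<exists>C\<ge>0. \<forall>k. norm (e k) \<le> C * \<rho> ^ k"
proof -
  define y where "y = norm (e 1 - t * e 0)"
  \<comment> \<open>Chosen to dominate \<open>e 0\<close> and to satisfy
    \<open>norm t * C + y \<le> C * \<rho>\<close>, which is what the induction step
    requires.\<close>
  define C where "C = norm (e 0) + y / (\<rho> - norm t)"
  have \<rho>: "\<rho> > 0" using t norm_ge_zero[of t] by linarith
  have "y \<ge> 0" by (simp add: y_def)
  then have "C \<ge> 0" using t by (simp add: C_def)
  have "y = (y / (\<rho> - norm t)) * (\<rho> - norm t)" using t by simp
  also have "\<dots> \<le> C * (\<rho> - norm t)" using t by (intro mult_right_mono) (auto simp: C_def)
  finally have C: "norm t * C + y \<le> C * \<rho>" by (simp add: algebra_simps)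
  have "norm (e k) \<le> C * \<rho> ^ k" for k
  proof (induction k)
    case 0
    then show ?case using t \<open>y \<ge> 0\<close> by (simp add: C_def)
  next
    case (Suc k)
    have "e (Suc k) = t * e k + s ^ k * (e 1 - t * e 0)"
      using linear_recurrence_factor[of e s t k, OF rec] by (simp add: algebra_simps)
    then have "norm (e (Suc k)) \<le> norm t * norm (e k) + norm s ^ k * y"
      by (metis norm_triangle_ineq norm_mult norm_power y_def)
    also have "\<dots> \<le> norm t * (C * \<rho> ^ k) + \<rho> ^ k * y"
      using Suc s \<open>y \<ge> 0\<close> by (intro add_mono mult_left_mono mult_right_mono power_mono) auto
    also have "\<dots> = (norm t * C + y) * \<rho> ^ k" by (simp add: algebra_simps)
    also have "\<dots> \<le> (C * \<rho>) * \<rho> ^ k" using C \<rho> by (intro mult_right_mono) auto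
    finally show ?case by (simp add: algebra_simps)
  qed
  then show ?thesis using \<open>C \<ge> 0\<close> by (intro exI[of _ C] conjI allI)
qed

text \<open>If the sequence scaled by \<open>\<kappa> ^ k\<close> tends to 0, so does its
  combination with its own shift that equals \<open>(\<kappa> * s) ^ k\<close> times
  \<open>e 1 - t * e 0\<close>. That factor is nonzero, so the geometric sequence itself tends to
  0.\<close>

lemma linear_recurrence_decay:
  fixes e :: "nat \<Rightarrow> complex"
  assumes rec: "\<And>k. e (Suc (Suc k)) = (s + t) * e (Suc k) - s * t * e k"
    and ne: "e 1 \<noteq> t * e 0" and \<kappa>: "\<kappa> > 0"
    and lim: "(\<lambda>k. \<kappa> ^ k * norm (e k)) \<longlonglongrightarrow> 0"
  shows "\<kappa> * norm s < 1"
proof -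
  define y where "y = e 1 - t * e 0"
  have lim': "(\<lambda>k. complex_of_real (\<kappa> ^ k) * e k) \<longlonglongrightarrow> 0"
    using lim \<kappa> by (intro tendsto_norm_zero_cancel[of "\<lambda>k. complex_of_real (\<kappa> ^ k) * e k"])
      (simp add: norm_mult norm_power)
  have "(\<lambda>k. (complex_of_real (\<kappa> ^ Suc k) * e (Suc k)) / \<kappa> - t * (complex_of_real (\<kappa> ^ k) * e k))
      \<longlonglongrightarrow> 0 / complex_of_real \<kappa> - t * 0"
    using \<kappa> by (intro tendsto_diff[OF tendsto_divide[OF LIMSEQ_Suc[OF lim'] tendsto_const]
        tendsto_mult[OF tendsto_const lim']]) simp
  also have "(\<lambda>k. (complex_of_real (\<kappa> ^ Suc k) * e (Suc k)) / \<kappa> - t * (complex_of_real (\<kappa> ^ k) * e k))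
      = (\<lambda>k. (\<kappa> * s) ^ k * y)"
  proof
    fix k
    have "(complex_of_real (\<kappa> ^ Suc k) * e (Suc k)) / \<kappa> - t * (complex_of_real (\<kappa> ^ k) * e k)
        = complex_of_real (\<kappa> ^ k) * (e (Suc k) - t * e k)"
      using \<kappa> by (simp add: algebra_simps)
    also have "\<dots> = (\<kappa> * s) ^ k * y"
      unfolding linear_recurrence_factor[of e s t k, OF rec] y_def
      by (simp add: power_mult_distrib)
    finally show "(complex_of_real (\<kappa> ^ Suc k) * e (Suc k)) / \<kappa> - t * (complex_of_real (\<kappa> ^ k) * e k)
        = (\<kappa> * s) ^ k * y" .
  qed
  finally have "(\<lambda>k. (\<kappa> * s) ^ k * y) \<longlonglongrightarrow> 0" by simp
  then have "(\<lambda>k. (\<kappa> * s) ^ k * y / y) \<longlonglongrightarrow> 0 / y"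
    using ne by (intro tendsto_divide) (auto simp: y_def)
  then have "(\<lambda>k. (\<kappa> * s) ^ k) \<longlonglongrightarrow> 0" using ne by (simp add: y_def)
  from tendstoD[OF this, of 1] obtain k where "norm (\<kappa> * s) ^ k < 1"
    by (auto simp: norm_power dest: eventually_happens)
  then have "norm (\<kappa> * s) < 1" using one_le_power[of "norm (\<kappa> * s)" k] by linarith
  then show ?thesis using \<kappa> by (simp add: norm_mult)
qed

lemma linear_recurrence_bounded:
  fixes e :: "nat \<Rightarrow> complex"
  assumes rec: "\<And>k. e (Suc (Suc k)) = (s + t) * e (Suc k) - s * t * e k"
    and ne: "e 1 \<noteq> t * e 0" and bdd: "\<And>k. norm (e k) \<le> C"
  shows "norm s \<le> 1"
proof (rule ccontr)
  assume s: "\<not> norm s \<le> 1"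
  \<comment> \<open>If \<open>norm s > 1\<close>, this scaling sends a bounded sequence to 0, and
    the decay criterion would then give \<open>1 < 1\<close>.\<close>
  define \<kappa> where "\<kappa> = 1 / norm s"
  have "norm s > 1" using s by simp
  then have \<kappa>: "0 < \<kappa>" "\<kappa> < 1" by (auto simp: \<kappa>_def divide_less_eq)
  have "(\<lambda>k. \<kappa> ^ k * C) \<longlonglongrightarrow> 0 * C"
    using \<kappa> by (intro tendsto_intros LIMSEQ_power_zero) auto
  then have lim: "(\<lambda>k. \<kappa> ^ k * C) \<longlonglongrightarrow> 0" by simp
  have "(\<lambda>k. \<kappa> ^ k * norm (e k)) \<longlonglongrightarrow> 0"
  proof (rule tendsto_sandwich[OF _ _ tendsto_const lim])
    show "\<forall>\<^sub>F k in sequentially. 0 \<le> \<kappa> ^ k * norm (e k)" using \<kappa> by simp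
    show "\<forall>\<^sub>F k in sequentially. \<kappa> ^ k * norm (e k) \<le> \<kappa> ^ k * C"
      using \<kappa> by (intro always_eventually allI mult_left_mono bdd) simp
  qed
  from linear_recurrence_decay[of e s t, OF rec ne \<kappa>(1) this]
  show False using s by (simp add: \<kappa>_def split: if_splits)
qed

section \<open>Elimination of the odd levels and the characteristic roots\<close>

lemma radial_eigen_odd:
  assumes "qm \<noteq> 0"
  shows "(of_nat qm + 1) * \<gamma> * radial_eigen qp qm \<gamma> (Suc (2 * k)) =
    radial_eigen qp qm \<gamma> (2 * k) + of_nat qm * radial_eigen qp qm \<gamma> (2 * Suc k)"
proof -
  have "radial_eigen qp qm \<gamma> (2 * Suc k) =
      ((of_nat qm + 1) * \<gamma> * radial_eigen qp qm \<gamma> (Suc (2 * k)) - radial_eigen qp qm \<gamma> (2 * k)) / of_nat qm"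
    by (simp add: Let_def)
  then show ?thesis using assms by (simp del: radial_eigen.simps mult_Suc_right)
qed

text \<open>Two steps outwards meet both branching numbers, whatever the starting even level. The
  equations at two consecutive odd levels and at the even level between them allow the odd values to
  be eliminated.\<close>

lemma radial_eigen_even_recurrence:
  assumes "qp \<noteq> 0" "qm \<noteq> 0"
  shows "of_nat (qp * qm) * radial_eigen qp qm \<gamma> (2 * Suc (Suc k)) =
    (Qf qp qm \<gamma> - (of_nat qp + of_nat qm)) * radial_eigen qp qm \<gamma> (2 * Suc k) -
    radial_eigen qp qm \<gamma> (2 * k)"
proof -
  let ?\<phi> = "radial_eigen qp qm \<gamma>"
  define p m :: complex where pm: "p = of_nat qp" "m = of_nat qm"
  have 1: "m * ?\<phi> (2 * Suc k) = (m + 1) * \<gamma> * ?\<phi> (Suc (2 * k)) - ?\<phi> (2 * k)"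
    and 2: "m * ?\<phi> (2 * Suc (Suc k)) = (m + 1) * \<gamma> * ?\<phi> (Suc (2 * Suc k)) - ?\<phi> (2 * Suc k)"
    by (simp_all only: pm radial_eigen_odd[OF assms(2)] add_diff_cancel_left')
  have 3: "p * ?\<phi> (Suc (2 * Suc k)) = (p + 1) * \<gamma> * ?\<phi> (2 * Suc k) - ?\<phi> (Suc (2 * k))"
    using assms by (simp add: Let_def pm)
  have "p * (m * ?\<phi> (2 * Suc (Suc k))) =
      (m + 1) * \<gamma> * (p * ?\<phi> (Suc (2 * Suc k))) - p * ?\<phi> (2 * Suc k)"
    unfolding 2 by (simp only: algebra_simps)
  also have "\<dots> = (p + 1) * (m + 1) * \<gamma>\<^sup>2 * ?\<phi> (2 * Suc k)
      - (m + 1) * \<gamma> * ?\<phi> (Suc (2 * k)) - p * ?\<phi> (2 * Suc k)"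
    unfolding 3 by (simp only: algebra_simps power2_eq_square)
  also have "(m + 1) * \<gamma> * ?\<phi> (Suc (2 * k)) = m * ?\<phi> (2 * Suc k) + ?\<phi> (2 * k)"
    unfolding 1 by simp
  finally show ?thesis
    unfolding Qf_def of_nat_mult pm[symmetric] by (simp only: algebra_simps)
qed

text \<open>The hypothesis on the value at distance 2 says
  \<open>(qm + 1) * \<gamma>\<^sup>2 = qm * t + 1\<close>. After this substitution the
  characteristic polynomial at \<open>t\<close> becomes
  \<open>(qm * t + 1) * (1 - t)\<close>.\<close>

lemma radial_eigen_2_eq_root:
  assumes q: "qp \<noteq> 0" "qm \<noteq> 0"
    and root: "of_nat (qp * qm) * t\<^sup>2 - (Qf qp qm \<gamma> - (of_nat qp + of_nat qm)) * t + 1 = 0"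
    and "radial_eigen qp qm \<gamma> 2 = t"
  shows "\<gamma> = 0 \<or> t = 1"
proof -
  define p m :: complex where pm: "p = of_nat qp" "m = of_nat qm"
  have "m \<noteq> 0" using q by (simp add: pm)
  have "m * t = (m + 1) * \<gamma>\<^sup>2 - 1"
    using assms(4) q by (auto simp: numeral_2_eq_2 Let_def pm power2_eq_square)
  then have g: "(m + 1) * \<gamma>\<^sup>2 = m * t + 1" by simp
  then have Q: "Qf qp qm \<gamma> = (p + 1) * (m * t + 1)"
    unfolding Qf_def pm[symmetric] by (metis mult.assoc)
  have "(m * t + 1) * (1 - t) = p * m * t\<^sup>2 - ((p + 1) * (m * t + 1) - (p + m)) * t + 1"
    by (simp add: algebra_simps power2_eq_square)
  also have "\<dots> = 0" using root unfolding Q of_nat_mult pm[symmetric] .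
  finally have "(m + 1) * \<gamma>\<^sup>2 * (1 - t) = 0" using g by simp
  moreover have "m + 1 \<noteq> 0" using of_nat_plus_1_neq_0 by (simp add: pm)
  ultimately show ?thesis by simp
qed

lemma radial_eigen_0:
  assumes "qm \<noteq> 0"
  shows "radial_eigen qp qm 0 (2 * k) = (- 1 / of_nat qm) ^ k"
    and "radial_eigen qp qm 0 (Suc (2 * k)) = 0"
proof -
  show "radial_eigen qp qm 0 (2 * k) = (- 1 / of_nat qm) ^ k"
    using assms by (induction k) (auto simp: Let_def)
  show "radial_eigen qp qm 0 (Suc (2 * k)) = 0"
    using assms by (induction k) (auto simp: Let_def)
qed

text \<open>Off the cuts the quadratic formula with \<open>R\<close> as square root of the
  discriminant makes one root equal to \<open>Bf\<close> divided by \<open>qgeo\<close>. On the cuts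
  \<open>R\<close> carries no information, but there the roots are complex conjugate with product
  \<open>1 / (qp * qm)\<close>, which matches the value 1 of \<open>B_abs\<close>. Ordering the
  roots by modulus loses track of which one comes from \<open>Bf\<close>, hence the
  disjunction.\<close>

lemma characteristic_roots:
  assumes q: "2 \<le> qp" "2 \<le> qm" and R: "sqrt_determination qp qm R"
  obtains s t :: complex where "s * t = 1 / of_nat (qp * qm)"
    "s + t = (Qf qp qm \<gamma> - (of_nat qp + of_nat qm)) / of_nat (qp * qm)"
    "norm t \<le> norm s"
    "B_abs qp qm R \<gamma> = qgeo qp qm * norm s \<or> B_abs qp qm R \<gamma> = qgeo qp qm * norm t"
proof -
  define N where "N = real (qp * qm)"
  define u where "u = Qf qp qm \<gamma> - (of_nat qp + of_nat qm)"
  have N: "N > 0" using q by (simp add: N_def)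
  have NN: "(of_nat (qp * qm) :: complex) = complex_of_real N" by (simp add: N_def)
  have g: "qgeo qp qm > 0" "qgeo qp qm * qgeo qp qm = N" using q by (auto simp: qgeo_def N_def)
  have W: "Wf qp qm \<gamma> = u\<^sup>2 - 4 * complex_of_real N"
    by (simp add: Wf_def u_def N_def algebra_simps power2_eq_square)
  have "\<exists>s t :: complex. s * t = 1 / N \<and> s + t = u / N \<and>
      B_abs qp qm R \<gamma> = qgeo qp qm * norm s"
  proof (cases "\<gamma> \<in> cuts qp qm")
    case False
    define s where "s = (u - R \<gamma>) / (2 * complex_of_real N)"
    define t where "t = (u + R \<gamma>) / (2 * complex_of_real N)"
    have "(R \<gamma>)\<^sup>2 = u\<^sup>2 - 4 * complex_of_real N"
      using R False W by (simp add: sqrt_determination_def)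
    then have "(u - R \<gamma>) * (u + R \<gamma>) = 4 * complex_of_real N"
      by (simp add: algebra_simps power2_eq_square)
    then have "s * t = 1 / N" using N by (simp add: s_def t_def)
    moreover have "s + t = u / N" using N by (simp add: s_def t_def field_simps)
    moreover have "Bf qp qm R \<gamma> = qgeo qp qm * s"
    proof -
      have "Bf qp qm R \<gamma> = (u - R \<gamma>) / (2 * complex_of_real (qgeo qp qm))"
        by (simp add: Bf_def u_def)
      also have "\<dots> = qgeo qp qm * s"
        using g unfolding s_def g(2)[symmetric] by simp
      finally show ?thesis .
    qed
    ultimately show ?thesis using False g by (auto simp: B_abs_def norm_mult)
  next
    case True
    define c where "c = (real qp + 1) * (real qm + 1)"
    have c: "c > 0" by (simp add: c_def add_pos_nonneg)
    obtain x where x: "\<gamma> = complex_of_real x" "cut_a qp qm < \<bar>x\<bar>" "\<bar>x\<bar> < cut_b qp qm"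
    proof -
      have "cut_a qp qm \<ge> 0" by (simp add: cut_a_def)
      then show thesis using True that unfolding cuts_def by fastforce
    qed
    \<comment> \<open>The ends of the cuts are the points where this quantity is
      \<open>- 2 * qgeo qp qm\<close> or \<open>2 * qgeo qp qm\<close>, that is, where the two roots
      coincide.\<close>
    define v where "v = c * x\<^sup>2 - (real qp + real qm)"
    have uv: "u = complex_of_real v" by (simp add: u_def v_def Qf_def x c_def)
    have sq: "(sqrt (real qp) - sqrt (real qm))\<^sup>2 = real qp + real qm - 2 * qgeo qp qm"
      "(sqrt (real qp) + sqrt (real qm))\<^sup>2 = real qp + real qm + 2 * qgeo qp qm"
      by (simp_all add: power2_diff power2_sum qgeo_def real_sqrt_mult)
    have a2: "(cut_a qp qm)\<^sup>2 = (real qp + real qm - 2 * qgeo qp qm) / c"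
      and b2: "(cut_b qp qm)\<^sup>2 = (real qp + real qm + 2 * qgeo qp qm) / c"
      using c sq by (simp_all add: cut_a_def cut_b_def power_divide flip: c_def)
    have "(cut_a qp qm)\<^sup>2 < x\<^sup>2" using x(2) power_strict_mono[of "cut_a qp qm" "\<bar>x\<bar>" 2]
      by (simp add: cut_a_def)
    then have l: "- 2 * qgeo qp qm < v"
      using c by (simp add: a2 v_def pos_divide_less_eq mult.commute)
    have "x\<^sup>2 < (cut_b qp qm)\<^sup>2" using x(3) power_strict_mono[of "\<bar>x\<bar>" "cut_b qp qm" 2] by simp
    then have "v < 2 * qgeo qp qm"
      using c by (simp add: b2 v_def pos_less_divide_eq mult.commute)
    with l have "\<bar>v\<bar> < \<bar>2 * qgeo qp qm\<bar>" by auto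
    then have "v\<^sup>2 < (2 * qgeo qp qm)\<^sup>2" by (rule power2_strict_mono)
    then have v4: "v\<^sup>2 < 4 * N" using g by (simp add: power2_eq_square)
    \<comment> \<open>A root of the real polynomial N X^2 - v X + 1, whose discriminant is negative;
      the other root is its conjugate.\<close>
    define s where "s = Complex (v / (2 * N)) (sqrt (4 * N - v\<^sup>2) / (2 * N))"
    have n2: "(norm s)\<^sup>2 = 1 / N"
      using N v4 unfolding s_def cmod_power2
      by (simp add: power_divide) (simp add: field_simps power2_eq_square)
    have "s * cnj s = 1 / N" using n2 by (simp add: complex_norm_square[symmetric])
    moreover have "s + cnj s = u / N"
      using N by (simp add: complex_add_cnj uv s_def)
    moreover have "qgeo qp qm * norm s = 1"
    proof -
      have "(qgeo qp qm * norm s)\<^sup>2 = 1"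
        using n2 g N by (simp add: power_mult_distrib) (simp add: power2_eq_square)
      then show ?thesis using g by (simp add: power2_eq_1_iff) (smt (verit) mult_nonneg_nonneg norm_ge_zero)
    qed
    ultimately show ?thesis using True by (metis B_abs_def)
  qed
  then obtain s t :: complex where st: "s * t = 1 / N" "s + t = u / N"
    "B_abs qp qm R \<gamma> = qgeo qp qm * norm s" by blast
  show thesis
  proof (cases "norm t \<le> norm s")
    case True
    then show ?thesis using that[of s t] st NN u_def by auto
  next
    case False
    then show ?thesis using that[of t s] st NN u_def by (auto simp: mult.commute add.commute)
  qed
qed

section \<open>Growth of spherical functions\<close>

lemma qgeo_gt_1:
  assumes "2 \<le> qp" "2 \<le> qm"
  shows "qgeo qp qm > 1"
proof -
  have "1 * 1 < real qp * real qm" using assms by (intro mult_strict_mono) auto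
  then show ?thesis by (simp add: qgeo_def)
qed

lemma qgeo_squared: "qgeo qp qm * qgeo qp qm = real (qp * qm)"
  by (simp add: qgeo_def)

lemma power_powr_commute:
  fixes x :: real
  assumes "x > 0"
  shows "(x ^ k) powr a = (x powr a) ^ k"
  using assms by (simp add: powr_powr mult.commute flip: powr_realpow)

text \<open>Comparison with the geometric series of ratio \<open>sqrt \<sigma>\<close>; dividing by
  that ratio compensates for the rounding of \<open>n div 2\<close> at odd \<open>n\<close>.\<close>

lemma summable_power_half:
  fixes \<sigma> :: real
  assumes "0 < \<sigma>" "\<sigma> < 1"
  shows "summable (\<lambda>n. \<sigma> ^ (n div 2))"
proof -
  define \<tau> where "\<tau> = sqrt \<sigma>"
  have \<tau>: "0 < \<tau>" "\<tau> < 1" "\<tau> ^ 2 = \<sigma>" using assms by (auto simp: \<tau>_def)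
  have "norm (\<sigma> ^ (n div 2)) \<le> \<tau> ^ n / \<tau>" for n
  proof -
    have "\<tau> ^ Suc (2 * (n div 2)) \<le> \<tau> ^ n" using \<tau> by (intro power_decreasing) auto
    then have "\<tau> * \<sigma> ^ (n div 2) \<le> \<tau> ^ n" using \<tau> by (simp add: power_mult)
    then show ?thesis using \<tau> assms by (simp add: pos_le_divide_eq mult.commute)
  qed
  moreover have "summable (\<lambda>n. \<tau> ^ n / \<tau>)"
    using \<tau> by (intro summable_divide summable_geometric) auto
  ultimately show ?thesis by (rule summable_comparison_test'[rotated])
qed

context rooted_semihomogeneous_tree
begin

abbreviation eigen :: "complex \<Rightarrow> nat \<Rightarrow> complex" where
  "eigen \<equiv> radial_eigen qp qm"

lemma q_pos: "qp \<noteq> 0" "qm \<noteq> 0"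
  using qp_ge qm_ge by auto

lemma q_prod_gt_1: "real (qp * qm) > 1"
  using qgeo_gt_1[OF qp_ge qm_ge] qgeo_squared[of qp qm] less_1_mult by metis

lemma spherical_in_lp_iff:
  "spherical adj v0 \<gamma> \<in> lp_space p \<longleftrightarrow>
     summable (\<lambda>n. of_nat (sphere_size n) * norm (eigen \<gamma> n) powr p)"
  unfolding lp_space_def spherical_eq mem_Collect_eq by (rule summable_on_lev_iff) simp

lemma sphere_size_le: "sphere_size n \<le> 2 * Suc qp * (qp * qm) ^ (n div 2)"
proof (cases "even n")
  case True
  then obtain k where n: "n = 2 * k" by (rule evenE)
  have "2 * (qp * qm) ^ k \<le> 2 * Suc qp * (qp * qm) ^ k" by (intro mult_le_mono1) simp
  then show ?thesis using sphere_size_even_le[of k] unfolding n by simp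
next
  case False
  then obtain k where n: "n = 2 * k + 1" by (rule oddE)
  have "n div 2 = k" "n = Suc (2 * k)" using n by simp_all
  then show ?thesis using sphere_size_odd_le[of k] by (simp only:)
qed

lemma spherical_in_lp:
  assumes p: "p > 0" and \<rho>: "\<rho> > 0" "real (qp * qm) * \<rho> powr p < 1"
    and bound: "\<And>n. norm (eigen \<gamma> n) \<le> C * \<rho> ^ (n div 2)"
  shows "spherical adj v0 \<gamma> \<in> lp_space p"
proof -
  define N where "N = real (qp * qm)"
  define \<sigma> where "\<sigma> = N * \<rho> powr p"
  define D where "D = real (2 * Suc qp) * C powr p"
  have "N > 0" using q_prod_gt_1 by (simp add: N_def)
  then have \<sigma>: "0 < \<sigma>" "\<sigma> < 1" using \<rho> by (auto simp: \<sigma>_def N_def)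
  have C: "C \<ge> 0" using order_trans[OF norm_ge_zero bound[of 0]] by simp
  have "norm (of_nat (sphere_size n) * norm (eigen \<gamma> n) powr p) \<le> D * \<sigma> ^ (n div 2)" for n
  proof -
    have "norm (eigen \<gamma> n) powr p \<le> (C * \<rho> ^ (n div 2)) powr p"
      using p by (intro powr_mono2 bound) auto
    also have "\<dots> = C powr p * (\<rho> powr p) ^ (n div 2)"
      using C \<rho> by (simp add: powr_mult power_powr_commute)
    finally have 1: "norm (eigen \<gamma> n) powr p \<le> C powr p * (\<rho> powr p) ^ (n div 2)" .
    have "real (sphere_size n) \<le> real (2 * Suc qp * (qp * qm) ^ (n div 2))"
      using sphere_size_le of_nat_le_iff by blast
    then have 2: "real (sphere_size n) \<le> real (2 * Suc qp) * N ^ (n div 2)"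
      by (simp only: N_def of_nat_mult of_nat_power)
    have "real (sphere_size n) * norm (eigen \<gamma> n) powr p
        \<le> (real (2 * Suc qp) * N ^ (n div 2)) * (C powr p * (\<rho> powr p) ^ (n div 2))"
      using 1 2 \<open>N > 0\<close> by (intro mult_mono) auto
    also have "\<dots> = D * \<sigma> ^ (n div 2)"
      by (simp only: D_def \<sigma>_def power_mult_distrib mult_ac)
    finally show ?thesis by simp
  qed
  moreover have "summable (\<lambda>n. D * \<sigma> ^ (n div 2))"
    by (intro summable_mult summable_power_half \<sigma>)
  ultimately show ?thesis
    unfolding spherical_in_lp_iff by (rule summable_comparison_test'[rotated])
qed

text \<open>The even spheres alone suffice: their contributions tend to 0, and each has at least
  \<open>(qp * qm) ^ k\<close> vertices.\<close>

lemma spherical_in_lp_imp_tendsto_0: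
  assumes "spherical adj v0 \<gamma> \<in> lp_space p"
  shows "(\<lambda>k. real (qp * qm) ^ k * norm (eigen \<gamma> (2 * k)) powr p) \<longlonglongrightarrow> 0"
proof -
  define f where "f n = real (sphere_size n) * norm (eigen \<gamma> n) powr p" for n
  have "f \<longlonglongrightarrow> 0"
    using assms summable_LIMSEQ_zero unfolding spherical_in_lp_iff f_def by blast
  then have "(f \<circ> (\<lambda>k. 2 * k)) \<longlonglongrightarrow> 0"
    by (rule LIMSEQ_subseq_LIMSEQ) (simp add: strict_mono_def)
  then have lim: "(\<lambda>k. f (2 * k)) \<longlonglongrightarrow> 0" by (simp add: o_def)
  show ?thesis
  proof (rule tendsto_sandwich[OF _ _ tendsto_const lim])
    show "\<forall>\<^sub>F k in sequentially. real (qp * qm) ^ k * norm (eigen \<gamma> (2 * k)) powr p \<le> f (2 * k)"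
      unfolding f_def
      by (intro always_eventually allI mult_right_mono)
        (metis of_nat_le_iff of_nat_power sphere_size_even_ge, simp)
  qed (simp add: always_eventually)
qed

section \<open>The spherical function with eigenvalue 0\<close>

lemma eigen_0_bound: "norm (eigen 0 n) \<le> 1 * (1 / real qm) ^ (n div 2)"
proof (cases "even n")
  case True
  then obtain k where n: "n = 2 * k" by (rule evenE)
  then show ?thesis
    using radial_eigen_0(1)[of qm qp k] q_pos by (simp add: norm_power norm_divide)
next
  case False
  then obtain k where n: "n = Suc (2 * k)" by (metis oddE Suc_eq_plus1)
  then show ?thesis using radial_eigen_0(2)[of qm qp k] q_pos by simp
qed

text \<open>Over two levels the spheres grow by \<open>qp * qm\<close> while the p-th powers of the
  values shrink by \<open>qm powr p\<close>. The critical exponent is where the two balance.\<close>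

lemma spherical_0_in_lp:
  assumes "p > p_crit qp qm"
  shows "spherical adj v0 0 \<in> lp_space p"
proof (rule spherical_in_lp[OF _ _ _ eigen_0_bound])
  have l: "ln (real qm) > 0" "ln (real qp * real qm) > 0"
    using qm_ge q_prod_gt_1 by auto
  then have "p_crit qp qm > 0" by (simp add: p_crit_def)
  then show "p > 0" using assms by simp
  have "ln (real qp * real qm) < p * ln (real qm)"
    using assms l unfolding p_crit_def by (simp add: pos_divide_less_eq)
  then have "exp (ln (real qp * real qm)) < exp (p * ln (real qm))" by simp
  then have "real qp * real qm < real qm powr p" using q_pos by (simp add: powr_def)
  then show "real (qp * qm) * (1 / real qm) powr p < 1"
    using q_pos by (simp add: powr_divide)
qed (use q_pos in simp)

text \<open>The squares of the values on the sphere of radius \<open>2 * k\<close> add up to at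
  least \<open>(qp / qm) ^ k\<close>, which does not tend to 0.\<close>

lemma spherical_0_not_in_l2:
  assumes "qm \<le> qp"
  shows "spherical adj v0 0 \<notin> lp_space 2"
proof
  assume "spherical adj v0 0 \<in> lp_space 2"
  from tendstoD[OF spherical_in_lp_imp_tendsto_0[OF this], of 1] obtain k
    where k: "real (qp * qm) ^ k * norm (eigen 0 (2 * k)) powr 2 < 1"
    by (auto dest: eventually_happens)
  have "norm (eigen 0 (2 * k)) = (1 / real qm) ^ k"
    using radial_eigen_0(1)[of qm qp k] q_pos by (simp add: norm_power norm_divide)
  then have "norm (eigen 0 (2 * k)) powr 2 = (1 / real qm * (1 / real qm)) ^ k"
    by (simp add: powr_numeral power2_eq_square flip: power_mult_distrib)
  then have "real (qp * qm) ^ k * norm (eigen 0 (2 * k)) powr 2 = (real qp / real qm) ^ k"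
    using q_pos by (simp flip: power_mult_distrib)
  moreover have "real qp / real qm \<ge> 1" using assms q_pos by simp
  ultimately show False using k one_le_power[of "real qp / real qm" k] by linarith
qed

section \<open>Summability and boundedness in terms of the larger characteristic root\<close>

context
  fixes \<gamma> s t :: complex
  assumes prod: "s * t = 1 / of_nat (qp * qm)"
    and sum: "s + t = (Qf qp qm \<gamma> - (of_nat qp + of_nat qm)) / of_nat (qp * qm)"
    and t_le_s: "norm t \<le> norm s"
begin

lemma eigen_recurrence:
  "eigen \<gamma> (2 * Suc (Suc k)) = (s + t) * eigen \<gamma> (2 * Suc k) - s * t * eigen \<gamma> (2 * k)"
proof -
  define N :: complex where "N = of_nat (qp * qm)"
  have N: "N \<noteq> 0" using q_pos by (simp add: N_def)
  have "N * eigen \<gamma> (2 * Suc (Suc k)) = (N * (s + t)) * eigen \<gamma> (2 * Suc k) - (N * (s * t)) * eigen \<gamma> (2 * k)"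
    using radial_eigen_even_recurrence[OF q_pos, of \<gamma> k] N
    unfolding prod sum N_def[symmetric] by simp
  also have "\<dots> = N * ((s + t) * eigen \<gamma> (2 * Suc k) - s * t * eigen \<gamma> (2 * k))"
    by (simp only: algebra_simps)
  finally show ?thesis using N by simp
qed

lemma norm_prod: "norm s * norm t = 1 / real (qp * qm)"
  using arg_cong[OF prod, of norm] by (simp add: norm_mult norm_divide)

text \<open>The roots have product of modulus below 1, so the smaller one lies inside the unit disc.
  This excludes \<open>t = 1\<close> below and supplies the strict inequality needed for bounds of
  order 1.\<close>

lemma norm_t_less_1: "norm t < 1"
proof (rule ccontr)
  assume "\<not> norm t < 1"
  then have "1 * 1 \<le> norm s * norm t" using t_le_s by (intro mult_mono) auto
  then show False using norm_prod q_prod_gt_1 by (simp add: field_simps)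
qed

text \<open>The component along the larger root does not vanish, which makes the growth criteria in
  \<open>s\<close> sharp. The indices are left as \<open>2 * 1\<close> and \<open>2 * 0\<close> to
  match the even subsequence in the recurrence lemmas.\<close>

lemma not_small_solution:
  assumes "\<gamma> \<noteq> 0"
  shows "eigen \<gamma> (2 * 1) \<noteq> t * eigen \<gamma> (2 * 0)"
proof
  assume "eigen \<gamma> (2 * 1) = t * eigen \<gamma> (2 * 0)"
  then have t: "eigen \<gamma> 2 = t" by simp
  define N :: complex where "N = of_nat (qp * qm)"
  have N: "N \<noteq> 0" using q_pos by (simp add: N_def)
  have "N * t\<^sup>2 - (N * (s + t)) * t + N * (s * t) = 0"
    by (simp add: algebra_simps power2_eq_square)
  then have "N * t\<^sup>2 - (Qf qp qm \<gamma> - (of_nat qp + of_nat qm)) * t + 1 = 0"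
    using N unfolding prod sum N_def[symmetric] by simp
  from radial_eigen_2_eq_root[OF q_pos this[unfolded N_def] t] have "t = 1" using assms by simp
  then show False using norm_t_less_1 by simp
qed

lemma eigen_bound:
  assumes \<gamma>: "\<gamma> \<noteq> 0" and "norm s \<le> \<rho>" "norm t < \<rho>"
  shows "\<exists>C. \<forall>n. norm (eigen \<gamma> n) \<le> C * \<rho> ^ (n div 2)"
proof -
  obtain C where C: "C \<ge> 0" "\<And>k. norm (eigen \<gamma> (2 * k)) \<le> C * \<rho> ^ k"
    using linear_recurrence_bound[of "\<lambda>k. eigen \<gamma> (2 * k)" s t \<rho>, OF eigen_recurrence assms(2,3)]
    by blast
  \<comment> \<open>An odd value times \<open>m\<close> is a combination of its two even neighbours,
    so \<open>\<gamma> \<noteq> 0\<close> permits the bound to be carried over to odd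
    levels.\<close>
  define m where "m = (of_nat qm + 1) * \<gamma>"
  have m: "norm m > 0" using \<gamma> of_nat_plus_1_neq_0 by (simp add: m_def)
  define C' where "C' = C * (1 + real qm * \<rho>) / norm m"
  have \<rho>: "\<rho> > 0" using assms(3) norm_ge_zero[of t] by linarith
  have odd_bound: "norm (eigen \<gamma> (Suc (2 * k))) \<le> C' * \<rho> ^ k" for k
  proof -
    have "norm m * norm (eigen \<gamma> (Suc (2 * k))) =
        norm (eigen \<gamma> (2 * k) + of_nat qm * eigen \<gamma> (2 * Suc k))"
      using radial_eigen_odd[OF q_pos(2), of \<gamma> qp k] unfolding m_def norm_mult[symmetric] by metis
    also have "\<dots> \<le> norm (eigen \<gamma> (2 * k)) + real qm * norm (eigen \<gamma> (2 * Suc k))"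
      by (rule norm_triangle_le) (simp only: norm_mult norm_of_nat order_refl)
    also have "\<dots> \<le> C * \<rho> ^ k + real qm * (C * \<rho> ^ Suc k)"
      by (intro add_mono mult_left_mono C) auto
    also have "\<dots> = norm m * (C' * \<rho> ^ k)" using m by (simp add: C'_def) (simp only: algebra_simps power_Suc)
    finally show ?thesis using m by simp
  qed
  have "norm (eigen \<gamma> n) \<le> max C C' * \<rho> ^ (n div 2)" for n
  proof (cases "even n")
    case True
    then obtain k where n: "n = 2 * k" by (rule evenE)
    have "C * \<rho> ^ k \<le> max C C' * \<rho> ^ k" using \<rho> by (intro mult_right_mono) auto
    then show ?thesis using C(2)[of k] n by simp
  next
    case False
    then obtain k where n: "n = Suc (2 * k)" by (metis oddE Suc_eq_plus1)
    have "C' * \<rho> ^ k \<le> max C C' * \<rho> ^ k" using \<rho> by (intro mult_right_mono) auto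
    then show ?thesis using odd_bound[of k] n by simp
  qed
  then show ?thesis by (intro exI[of _ "max C C'"] allI)
qed

text \<open>For necessity, the 1/p-th power of the vanishing contributions is the even subsequence
  scaled by \<open>(qp * qm) powr (1 / p)\<close> to the power \<open>k\<close>, so the decay
  criterion applies. For sufficiency, a bound of order \<open>\<rho> ^ k\<close> with
  \<open>\<rho>\<close> slightly above \<open>norm s\<close> is summed over the spheres.\<close>

lemma spherical_in_lp_iff_root:
  assumes \<gamma>: "\<gamma> \<noteq> 0" and p: "p > 0"
  shows "spherical adj v0 \<gamma> \<in> lp_space p \<longleftrightarrow> real (qp * qm) powr (1 / p) * norm s < 1"
proof
  define N where "N = real (qp * qm)"
  have N: "N > 0" using q_prod_gt_1 by (simp add: N_def)
  show "real (qp * qm) powr (1 / p) * norm s < 1" if lp: "spherical adj v0 \<gamma> \<in> lp_space p"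
  proof (rule linear_recurrence_decay[of "\<lambda>k. eigen \<gamma> (2 * k)" s t, OF eigen_recurrence])
    have "(\<lambda>k. (N ^ k * norm (eigen \<gamma> (2 * k)) powr p) powr (1 / p)) \<longlonglongrightarrow> 0"
      using spherical_in_lp_imp_tendsto_0[OF lp] p N
      by (intro tendsto_zero_powrI[OF _ tendsto_const]) (auto simp: N_def)
    moreover have "(N ^ k * norm (eigen \<gamma> (2 * k)) powr p) powr (1 / p) =
        (N powr (1 / p)) ^ k * norm (eigen \<gamma> (2 * k))" for k
    proof -
      have "(N ^ k) powr (1 / p) = (N powr (1 / p)) ^ k" by (rule power_powr_commute[OF N])
      then show ?thesis using p N by (simp add: powr_mult powr_powr del: of_nat_mult)
    qed
    ultimately show "(\<lambda>k. (real (qp * qm) powr (1 / p)) ^ k * norm (eigen \<gamma> (2 * k))) \<longlonglongrightarrow> 0"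
      by (simp only: N_def)
  qed (use not_small_solution[OF \<gamma>] q_pos in auto)
  assume "real (qp * qm) powr (1 / p) * norm s < 1"
  then have "norm s < N powr (- 1 / p)"
    using N unfolding N_def[symmetric] by (simp add: powr_minus field_simps)
  \<comment> \<open>Strictly above \<open>norm s\<close>, because the two roots may have equal
    modulus and the growth bound requires \<open>norm t < \<rho>\<close>.\<close>
  then obtain \<rho> where \<rho>: "norm s < \<rho>" "\<rho> < N powr (- 1 / p)" using dense by blast
  have \<rho>0: "\<rho> > 0" using \<rho>(1) norm_ge_zero[of s] by linarith
  have "\<rho> powr p < (N powr (- 1 / p)) powr p" using \<rho> \<rho>0 p by (intro powr_less_mono2) auto
  also have "\<dots> = 1 / N" unfolding powr_powr using p N by (simp add: powr_minus_divide)
  finally have "N * \<rho> powr p < 1" using N by (simp add: field_simps)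
  moreover obtain C where "\<And>n. norm (eigen \<gamma> n) \<le> C * \<rho> ^ (n div 2)"
    using eigen_bound[OF \<gamma>, of \<rho>] \<rho> t_le_s by fastforce
  ultimately show "spherical adj v0 \<gamma> \<in> lp_space p"
    using spherical_in_lp[OF p \<rho>0, of \<gamma> C] by (simp only: N_def)
qed

lemma bounded_spherical_iff:
  assumes \<gamma>: "\<gamma> \<noteq> 0"
  shows "bounded (range (spherical adj v0 \<gamma>)) \<longleftrightarrow> norm s \<le> 1"
proof
  assume "bounded (range (spherical adj v0 \<gamma>))"
  then obtain C where C: "\<And>v. norm (eigen \<gamma> (lev v)) \<le> C"
    unfolding spherical_eq bounded_iff by auto
  have "norm (eigen \<gamma> (2 * k)) \<le> C" for k
    using sphere_nonempty[of "2 * k"] C by metis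
  then show "norm s \<le> 1"
    using linear_recurrence_bounded[of "\<lambda>k. eigen \<gamma> (2 * k)" s t C, OF eigen_recurrence]
      not_small_solution[OF \<gamma>] by blast
next
  assume "norm s \<le> 1"
  \<comment> \<open>The borderline \<open>norm s = 1\<close> is included, since only
    \<open>t\<close> has to stay strictly below the rate.\<close>
  then obtain C where "\<And>n. norm (eigen \<gamma> n) \<le> C * 1 ^ (n div 2)"
    using eigen_bound[OF \<gamma>, of 1] norm_t_less_1 by blast
  then show "bounded (range (spherical adj v0 \<gamma>))"
    unfolding spherical_eq bounded_iff by (intro exI[of _ C]) auto
qed

text \<open>At eigenvalue 0 the characteristic polynomial has the roots \<open>- 1 / qp\<close> and
  \<open>- 1 / qm\<close>. Thus the boundedness criterion also holds for 0, which the growth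
  argument leaves out.\<close>

lemma norm_root_0:
  assumes "\<gamma> = 0"
  shows "norm s \<le> 1"
proof -
  define p m :: complex where pm: "p = of_nat qp" "m = of_nat qm"
  have nz: "p \<noteq> 0" "m \<noteq> 0" using q_pos by (auto simp: pm)
  have "s + t = - (p + m) / (p * m)" using sum by (simp add: assms Qf_def pm)
  also have "\<dots> = - (1 / p + 1 / m)" using nz by (simp add: field_simps)
  finally have "t = - (1 / p + 1 / m) - s" by (simp add: algebra_simps)
  then have "s * (- (1 / p + 1 / m) - s) = 1 / (p * m)"
    using prod by (simp add: pm)
  moreover have "(s + 1 / p) * (s + 1 / m) = 1 / (p * m) - s * (- (1 / p + 1 / m) - s)"
    using nz by (simp add: field_simps)
  ultimately have "(s + 1 / p) * (s + 1 / m) = 0" by simp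
  then have "s = - (1 / p) \<or> s = - (1 / m)" by (auto simp: eq_neg_iff_add_eq_0)
  then show ?thesis using q_pos by (auto simp: pm norm_divide)
qed

end

text \<open>Here z is \<open>qgeo\<close> times the modulus of the larger root, and the same
  multiple of the smaller root has modulus \<open>1 / z\<close>. Since \<open>qp * qm\<close> is the
  square of \<open>qgeo\<close>, the root criteria become the stated bounds on z, with no reference
  to the branch.\<close>

lemma B_abs_characterization:
  assumes R: "sqrt_determination qp qm R"
  shows "\<exists>z\<ge>1. (B_abs qp qm R \<gamma> = z \<or> B_abs qp qm R \<gamma> = 1 / z) \<and>
    (\<forall>p>0. \<gamma> \<noteq> 0 \<longrightarrow>
       (spherical adj v0 \<gamma> \<in> lp_space p \<longleftrightarrow> z < qgeo qp qm powr (1 - 2 / p))) \<and>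
    (bounded (range (spherical adj v0 \<gamma>)) \<longleftrightarrow> z \<le> qgeo qp qm)"
proof -
  obtain s t where prod: "s * t = 1 / of_nat (qp * qm)"
    and sum: "s + t = (Qf qp qm \<gamma> - (of_nat qp + of_nat qm)) / of_nat (qp * qm)"
    and le: "norm t \<le> norm s"
    and B: "B_abs qp qm R \<gamma> = qgeo qp qm * norm s \<or> B_abs qp qm R \<gamma> = qgeo qp qm * norm t"
    using characteristic_roots[OF qp_ge qm_ge R, of \<gamma>] by metis
  define q where "q = qgeo qp qm"
  have q: "q > 1" "real (qp * qm) = q * q"
    using qgeo_gt_1[OF qp_ge qm_ge] qgeo_squared[of qp qm] by (simp_all add: q_def)
  have st: "(q * norm s) * (q * norm t) = 1"
    using norm_prod[OF prod sum le] q(1) unfolding q(2) by (simp add: field_simps)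
  show ?thesis
  proof (intro exI[of _ "q * norm s"] conjI allI impI)
    have "q * norm t \<le> q * norm s" using le q by simp
    then have "1 \<le> (q * norm s) * (q * norm s)"
      using mult_left_mono[of "q * norm t" "q * norm s" "q * norm s"] st q by simp
    then have "1\<^sup>2 \<le> (q * norm s)\<^sup>2" by (simp add: power2_eq_square)
    then show "1 \<le> q * norm s" using q by (intro power2_le_imp_le[of 1]) auto
    then have "q * norm s \<noteq> 0" by linarith
    then have "q * norm t = 1 / (q * norm s)" using st by (metis nonzero_mult_div_cancel_left)
    then show "B_abs qp qm R \<gamma> = q * norm s \<or> B_abs qp qm R \<gamma> = 1 / (q * norm s)"
      using B by (auto simp: q_def)
    show "spherical adj v0 \<gamma> \<in> lp_space p \<longleftrightarrow> q * norm s < qgeo qp qm powr (1 - 2 / p)"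
      if "p > 0" "\<gamma> \<noteq> 0" for p
    proof -
      have "(q * q) powr (1 / p) = q powr (2 / p)"
        using q by (simp add: powr_mult powr_add[symmetric])
      then show ?thesis
        using spherical_in_lp_iff_root[OF prod sum le that(2,1)] q(1)
        unfolding q(2) q_def[symmetric] by (simp add: powr_diff field_simps)
    qed
    show "bounded (range (spherical adj v0 \<gamma>)) \<longleftrightarrow> q * norm s \<le> qgeo qp qm"
    proof (cases "\<gamma> = 0")
      case True
      have "norm (eigen 0 n) \<le> 1" for n
        using eigen_0_bound[of n] power_le_one[of "1 / real qm" "n div 2"] q_pos by simp
      then have "bounded (range (spherical adj v0 0))"
        unfolding spherical_eq bounded_iff by (intro exI[of _ 1]) auto
      then show ?thesis using norm_root_0[OF prod sum le True] True q by (simp add: q_def)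
    next
      case False
      then show ?thesis using bounded_spherical_iff[OF prod sum le False] q by (simp add: q_def)
    qed
  qed
qed

end

section \<open>Spectrum and exponents\<close>

text \<open>The interval is invariant under inversion, so membership depends only on z, the larger
  of \<open>b\<close> and \<open>1 / b\<close>.\<close>

lemma powr_between_iff:
  fixes q z x :: real
  assumes "b = z \<or> b = 1 / z" "z \<ge> 1" "q > 1" "x > 0"
  shows "q powr (- x) < b \<and> b < q powr x \<longleftrightarrow> z < q powr x"
proof -
  have 1: "1 < q powr x" using assms by simp
  then have "q powr (- x) < 1" by (simp add: powr_minus inverse_less_1_iff)
  then have "q powr (- x) < z" using assms by linarith
  moreover have "1 / z \<le> 1" using assms by simp
  then have "1 / z < q powr x" using 1 by linarith
  moreover have "q powr (- x) < 1 / z \<longleftrightarrow> z < q powr x"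
    using assms 1 by (simp add: powr_minus field_simps)
  ultimately show ?thesis using assms(1) by auto
qed

lemma between_inverse_iff:
  fixes q z :: real
  assumes "b = z \<or> b = 1 / z" "z \<ge> 1" "q > 1"
  shows "1 / q \<le> b \<and> b \<le> q \<longleftrightarrow> z \<le> q"
proof -
  have "1 / z \<le> 1" "1 / q \<le> 1" using assms by auto
  then have "1 / q \<le> z" "1 / z \<le> q" using assms by linarith+
  moreover have "1 / q \<le> 1 / z \<longleftrightarrow> z \<le> q" using assms by (simp add: field_simps)
  ultimately show ?thesis using assms(1) by auto
qed

lemma all_less_powr_iff:
  fixes q z :: real
  assumes "z \<ge> 1" "q > 1"
  shows "(\<forall>p>2. z < q powr (1 - 2 / p)) \<longleftrightarrow> z = 1"
proof
  assume all: "\<forall>p>2. z < q powr (1 - 2 / p)"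
  show "z = 1"
  proof (rule ccontr)
    assume "z \<noteq> 1"
    then have z: "z > 1" using assms by simp
    \<comment> \<open>The exponent \<open>1 - 2 / p\<close> takes the value \<open>x\<close> at
      \<open>p = 2 / (1 - x)\<close>. The bound by \<open>log q z\<close> gives
      \<open>q powr x \<le> z\<close>, and the bound by 1/2 keeps \<open>1 - x\<close>
      positive.\<close>
    define x where "x = min (log q z) (1 / 2)"
    have x: "0 < x" "x \<le> 1 / 2" using z assms by (auto simp: x_def)
    have "2 / (1 - x) > 2" using x by (simp add: field_simps)
    then have "z < q powr (1 - 2 / (2 / (1 - x)))" using all by blast
    also have "1 - 2 / (2 / (1 - x)) = x" using x by (simp add: field_simps)
    also have "q powr x \<le> q powr (log q z)" using assms by (intro powr_mono) (auto simp: x_def)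
    also have "\<dots> = z" using z assms by simp
    finally show False by simp
  qed
qed (use assms in auto)

context rooted_semihomogeneous_tree
begin

lemma p_crit_less_2_iff: "p_crit qp qm < 2 \<longleftrightarrow> qp < qm"
proof -
  have l: "ln (real qm) > 0" using qm_ge by simp
  have "p_crit qp qm < 2 \<longleftrightarrow> ln (real qp * real qm) < ln (real qm) + ln (real qm)"
    using l by (simp add: p_crit_def pos_divide_less_eq)
  also have "\<dots> \<longleftrightarrow> ln (real qp) < ln (real qm)"
    using q_pos by (simp add: ln_mult)
  also have "\<dots> \<longleftrightarrow> qp < qm" using q_pos by simp
  finally show ?thesis .
qed

section \<open>Spherical functions as eigenfunctions, and the spectrum\<close>

lemma spherical_inj: "spherical adj v0 \<gamma> = spherical adj v0 \<gamma>' \<longleftrightarrow> \<gamma> = \<gamma>'"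
proof
  obtain v where v: "lev v = 1" using sphere_nonempty by blast
  assume "spherical adj v0 \<gamma> = spherical adj v0 \<gamma>'"
  from fun_cong[OF this, of v] show "\<gamma> = \<gamma>'" by (simp add: spherical_eq v)
qed simp

lemma laplace_spherical: "laplace adj (spherical adj v0 \<gamma>) v = \<gamma> * spherical adj v0 \<gamma> v"
  unfolding spherical_eq by (rule radial_eigen_laplace)

lemma radial_spherical: "radial adj v0 (spherical adj v0 \<gamma>)"
  by (simp add: spherical_eq radial_def)

lemma spherical_root: "spherical adj v0 \<gamma> v0 = 1"
  by (simp add: spherical_eq)

text \<open>Every nonzero radial eigenfunction is a multiple of the spherical one, and the factor,
  its value at the root, is nonzero.\<close>

lemma discrete_spectrum_iff:
  "\<gamma> \<in> l2_discrete_spectrum adj v0 \<longleftrightarrow> spherical adj v0 \<gamma> \<in> lp_space 2"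
proof
  assume "\<gamma> \<in> l2_discrete_spectrum adj v0"
  then obtain f where f: "f \<in> lp_space 2" "radial adj v0 f" "f \<noteq> (\<lambda>v. 0)"
    "\<And>v. laplace adj f v = \<gamma> * f v"
    by (auto simp: l2_discrete_spectrum_def)
  have eq: "f v = f v0 * spherical adj v0 \<gamma> v" for v
    unfolding spherical_eq by (rule radial_eigenfunction[OF f(2,4)])
  have "f v0 \<noteq> 0"
  proof
    assume "f v0 = 0"
    then have "f v = 0" for v using eq[of v] by simp
    then show False using f(3) by blast
  qed
  have "(\<lambda>v. norm (f v) powr 2 * inverse (norm (f v0) powr 2)) summable_on UNIV"
    using f(1) by (intro summable_on_cmult_left) (simp add: lp_space_def)
  moreover have "norm (f v) powr 2 * inverse (norm (f v0) powr 2) = norm (spherical adj v0 \<gamma> v) powr 2" for v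
    using \<open>f v0 \<noteq> 0\<close> by (subst eq[of v]) (simp add: norm_mult powr_mult)
  ultimately show "spherical adj v0 \<gamma> \<in> lp_space 2" by (simp add: lp_space_def)
next
  assume "spherical adj v0 \<gamma> \<in> lp_space 2"
  moreover have "spherical adj v0 \<gamma> \<noteq> (\<lambda>v. 0)"
    using spherical_root[of \<gamma>] by (metis zero_neq_one)
  ultimately show "\<gamma> \<in> l2_discrete_spectrum adj v0"
    using radial_spherical laplace_spherical unfolding l2_discrete_spectrum_def by blast
qed

text \<open>A nonzero kernel element destroys injectivity. The spectrum does not refer to a root, so
  a square-summable spherical function around any vertex is enough.\<close>

lemma spherical_in_l2_imp_spectrum:
  assumes "spherical adj v0 \<gamma> \<in> lp_space 2"
  shows "\<gamma> \<in> l2_spectrum adj"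
proof -
  have "laplace_minus adj \<gamma> (spherical adj v0 \<gamma>) = (\<lambda>v. 0)"
    by (simp add: laplace_minus_def laplace_spherical)
  moreover have "laplace_minus adj \<gamma> (\<lambda>v. 0) = (\<lambda>v. 0)"
    by (simp add: laplace_minus_def laplace_def)
  moreover have "(\<lambda>v. 0) \<in> lp_space 2" by (simp add: lp_space_def)
  moreover have "spherical adj v0 \<gamma> \<noteq> (\<lambda>v. 0)"
    using spherical_root[of \<gamma>] by (metis zero_neq_one)
  ultimately have "\<not> inj_on (laplace_minus adj \<gamma>) (lp_space 2)"
    using assms by (metis inj_onD)
  then show ?thesis by (auto simp: l2_spectrum_def bij_betw_def)
qed

end

theorem theorem7p4:
  fixes adj :: "'v \<Rightarrow> 'v \<Rightarrow> bool" and Vp Vm :: "'v set" and v0 :: 'v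
    and qp qm :: nat and R :: "complex \<Rightarrow> complex"
  assumes "semihomogeneous_tree adj Vp Vm qp qm"
    and "v0 \<in> Vp"
    and "sqrt_determination qp qm R"
  shows
    "(\<forall>p p'. p > 2 \<and> p' = 1 / (1 - 1 / p) \<longrightarrow>
        p' < 2 \<and>
        {\<gamma>. spherical adj v0 \<gamma> \<in> lp_space p} - {0} =
        {\<gamma>. qgeo qp qm powr (1 / p - 1 / p') < B_abs qp qm R \<gamma> \<and>
             B_abs qp qm R \<gamma> < qgeo qp qm powr (1 / p' - 1 / p)} - {0}) \<and>
     {\<gamma>. spherical adj v0 \<gamma> \<in> (\<Inter>p\<in>{2<..}. lp_space p)} - {0} =
       {\<gamma>. B_abs qp qm R \<gamma> = 1} - {0} \<and>
     ((\<exists>!\<phi>. \<phi> \<in> range (spherical adj v0) \<and> \<phi> \<in> lp_space 2) \<longleftrightarrow> qp < qm) \<and>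
     (qp < qm \<longrightarrow> spherical adj v0 0 \<in> lp_space 2) \<and>
     ((\<exists>!\<phi>. \<phi> \<in> range (spherical adj v0) \<and> \<phi> \<in> (\<Inter>p\<in>{p_crit qp qm<..}. lp_space p))
        \<longleftrightarrow> qp < qm) \<and>
     (\<forall>p > p_crit qp qm. spherical adj v0 0 \<in> lp_space p) \<and>
     (qp < qm \<longrightarrow> 0 \<in> l2_discrete_spectrum adj v0) \<and>
     (qp > qm \<longrightarrow> 0 \<in> l2_continuous_spectrum adj v0 \<and> 0 \<notin> l2_discrete_spectrum adj v0) \<and>
     {\<gamma>. bounded (range (spherical adj v0 \<gamma>))} =
       {\<gamma>. 1 / qgeo qp qm \<le> B_abs qp qm R \<gamma> \<and> B_abs qp qm R \<gamma> \<le> qgeo qp qm}"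
proof -
  interpret rooted_semihomogeneous_tree adj Vp Vm qp qm v0
    using assms(1,2) by unfold_locales
  note charac = B_abs_characterization[OF assms(3)]
  define q where "q = qgeo qp qm"
  have q: "q > 1" using qgeo_gt_1[OF qp_ge qm_ge] by (simp add: q_def)

  have lp: "spherical adj v0 \<gamma> \<in> lp_space p \<longleftrightarrow>
      q powr (1 / p - 1 / p') < B_abs qp qm R \<gamma> \<and> B_abs qp qm R \<gamma> < q powr (1 / p' - 1 / p)"
    and p': "p' < 2"
    if "p > 2" "p' = 1 / (1 - 1 / p)" "\<gamma> \<noteq> 0" for p p' \<gamma>
  proof -
    have "1 / p' = 1 - 1 / p" using that by simp
    then have exponent: "1 / p' - 1 / p = 1 - 2 / p" "1 / p - 1 / p' = - (1 - 2 / p)" by simp_all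
    have pos: "1 - 2 / p > 0" using that by (simp add: field_simps)
    obtain z where z: "z \<ge> 1" "B_abs qp qm R \<gamma> = z \<or> B_abs qp qm R \<gamma> = 1 / z"
      "\<forall>p>0. spherical adj v0 \<gamma> \<in> lp_space p \<longleftrightarrow> z < q powr (1 - 2 / p)"
      using charac[of \<gamma>] \<open>\<gamma> \<noteq> 0\<close> unfolding q_def by blast
    have "spherical adj v0 \<gamma> \<in> lp_space p \<longleftrightarrow> z < q powr (1 - 2 / p)"
      using z(3) that(1) by simp
    then show "spherical adj v0 \<gamma> \<in> lp_space p \<longleftrightarrow>
      q powr (1 / p - 1 / p') < B_abs qp qm R \<gamma> \<and> B_abs qp qm R \<gamma> < q powr (1 / p' - 1 / p)"
      unfolding exponent using powr_between_iff[OF z(2,1) q pos] by blast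
    define y where "y = 1 / p"
    have "y < 1 / 2" using that(1) by (simp add: y_def field_simps)
    then show "p' < 2" unfolding that(2) y_def[symmetric] by (simp add: field_simps)
  qed

  have inter: "(\<forall>p>2. spherical adj v0 \<gamma> \<in> lp_space p) \<longleftrightarrow> B_abs qp qm R \<gamma> = 1"
    if "\<gamma> \<noteq> 0" for \<gamma>
  proof -
    obtain z where z: "z \<ge> 1" "B_abs qp qm R \<gamma> = z \<or> B_abs qp qm R \<gamma> = 1 / z"
      "\<forall>p>0. spherical adj v0 \<gamma> \<in> lp_space p \<longleftrightarrow> z < q powr (1 - 2 / p)"
      using charac[of \<gamma>] \<open>\<gamma> \<noteq> 0\<close> unfolding q_def by blast
    have "(\<forall>p>2. spherical adj v0 \<gamma> \<in> lp_space p) \<longleftrightarrow> (\<forall>p>2. z < q powr (1 - 2 / p))"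
      using z(3) by auto
    also have "\<dots> \<longleftrightarrow> z = 1" by (rule all_less_powr_iff[OF z(1) q])
    also have "\<dots> \<longleftrightarrow> B_abs qp qm R \<gamma> = 1" using z(1,2) by auto
    finally show ?thesis .
  qed

  have not_l2: "spherical adj v0 \<gamma> \<notin> lp_space 2" if "\<gamma> \<noteq> 0" for \<gamma>
  proof -
    obtain z where z: "z \<ge> 1"
      "\<forall>p>0. spherical adj v0 \<gamma> \<in> lp_space p \<longleftrightarrow> z < q powr (1 - 2 / p)"
      using charac[of \<gamma>] \<open>\<gamma> \<noteq> 0\<close> unfolding q_def by blast
    \<comment> \<open>At \<open>p = 2\<close> the exponent is 0 and the criterion would read
      \<open>z < 1\<close>.\<close>
    then show ?thesis using q z(2)[rule_format, of 2] by simp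
  qed

  have zero_l2: "spherical adj v0 0 \<in> lp_space 2 \<longleftrightarrow> qp < qm"
    using spherical_0_in_lp[of 2] spherical_0_not_in_l2 p_crit_less_2_iff by (meson not_le)

  have unique_l2: "(\<exists>!\<phi>. \<phi> \<in> range (spherical adj v0) \<and> \<phi> \<in> lp_space 2) \<longleftrightarrow> qp < qm"
    using not_l2 zero_l2 by (metis (mono_tags, lifting) rangeE rangeI)

  have unique_crit: "(\<exists>!\<phi>. \<phi> \<in> range (spherical adj v0) \<and> \<phi> \<in> (\<Inter>p\<in>{p_crit qp qm<..}. lp_space p))
      \<longleftrightarrow> qp < qm"
  proof
    assume "qp < qm"
    then have "2 \<in> {p_crit qp qm<..}" using p_crit_less_2_iff by simp
    then have "\<phi> = spherical adj v0 0"
      if \<phi>: "\<phi> \<in> range (spherical adj v0)" "\<phi> \<in> (\<Inter>p\<in>{p_crit qp qm<..}. lp_space p)" for \<phi>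
    proof -
      have "\<phi> \<in> lp_space 2" using \<phi>(2) \<open>2 \<in> {p_crit qp qm<..}\<close> by (rule INT_D)
      moreover obtain \<gamma> where "\<phi> = spherical adj v0 \<gamma>" using \<phi>(1) by (rule rangeE)
      ultimately show ?thesis using not_l2[of \<gamma>] by (cases "\<gamma> = 0") simp_all
    qed
    then show "\<exists>!\<phi>. \<phi> \<in> range (spherical adj v0) \<and> \<phi> \<in> (\<Inter>p\<in>{p_crit qp qm<..}. lp_space p)"
      using spherical_0_in_lp by (intro ex1I[of _ "spherical adj v0 0"]) auto
  next
    assume unique: "\<exists>!\<phi>. \<phi> \<in> range (spherical adj v0) \<and> \<phi> \<in> (\<Inter>p\<in>{p_crit qp qm<..}. lp_space p)"
    show "qp < qm"
    proof (rule ccontr)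
      assume "\<not> qp < qm"
      then have crit: "p_crit qp qm \<ge> 2" using p_crit_less_2_iff by (meson not_le)
      \<comment> \<open>A nonzero eigenvalue inside a cut, where \<open>B_abs\<close> is 1. Its
        spherical function is in every space with exponent above 2, hence in every one above the
        critical exponent, and so competes with the function for 0.\<close>
      define x where "x = (cut_a qp qm + cut_b qp qm) / 2"
      have "sqrt (real qp) > 0" "sqrt (real qm) > 0" using q_pos by simp_all
      then have "\<bar>sqrt (real qp) - sqrt (real qm)\<bar> < sqrt (real qp) + sqrt (real qm)" by linarith
      then have "cut_a qp qm < cut_b qp qm"
        unfolding cut_a_def cut_b_def by (intro divide_strict_right_mono) auto
      moreover have "cut_a qp qm \<ge> 0" by (simp add: cut_a_def)
      ultimately have x: "x > 0" "x \<in> {cut_a qp qm<..<cut_b qp qm}" by (auto simp: x_def)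
      then have "complex_of_real x \<in> cuts qp qm" unfolding cuts_def by blast
      then have "B_abs qp qm R (complex_of_real x) = 1" by (simp add: B_abs_def)
      then have "spherical adj v0 (complex_of_real x) \<in> (\<Inter>p\<in>{p_crit qp qm<..}. lp_space p)"
        using inter[of "complex_of_real x"] x crit by auto
      moreover have "spherical adj v0 0 \<in> (\<Inter>p\<in>{p_crit qp qm<..}. lp_space p)"
        using spherical_0_in_lp by auto
      ultimately have "spherical adj v0 (complex_of_real x) = spherical adj v0 0"
        using unique by blast
      then show False using x by (simp add: spherical_inj)
    qed
  qed

  have continuous: "0 \<in> l2_continuous_spectrum adj v0" if "qm < qp"
  proof -
    \<comment> \<open>A neighbour of \<open>v0\<close> lies in the other class. Rooted there, the
      tree has the branching numbers exchanged, so the function for 0 becomes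
      square-summable.\<close>
    obtain w where "lev w = 1" using sphere_nonempty by blast
    then have "w \<notin> Vp" using Vp_iff_even_lev[of w] by simp
    then have w: "w \<in> Vm" using assms(1) by (auto simp: semihomogeneous_tree_def)
    have "semihomogeneous_tree adj Vm Vp qm qp"
      using assms(1) unfolding semihomogeneous_tree_def by auto
    then interpret swap: rooted_semihomogeneous_tree adj Vm Vp qm qp w
      using w by unfold_locales
    have "spherical adj w 0 \<in> lp_space 2"
      using swap.spherical_0_in_lp[of 2] swap.p_crit_less_2_iff that by blast
    then have "0 \<in> l2_spectrum adj" by (rule swap.spherical_in_l2_imp_spectrum)
    then show ?thesis
      using that zero_l2 by (simp add: l2_continuous_spectrum_def discrete_spectrum_iff)
  qed

  have bounded: "bounded (range (spherical adj v0 \<gamma>)) \<longleftrightarrow>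
      1 / q \<le> B_abs qp qm R \<gamma> \<and> B_abs qp qm R \<gamma> \<le> q" for \<gamma>
  proof -
    obtain z where "z \<ge> 1" "B_abs qp qm R \<gamma> = z \<or> B_abs qp qm R \<gamma> = 1 / z"
      "bounded (range (spherical adj v0 \<gamma>)) \<longleftrightarrow> z \<le> q"
      using charac[of \<gamma>] unfolding q_def by blast
    then show ?thesis using between_inverse_iff[OF _ _ q] by blast
  qed

  show ?thesis
  proof (intro conjI allI impI)
    \<comment> \<open>The bound was proved jointly with the criterion for nonzero eigenvalues; the
      eigenvalue 1 is an arbitrary instance.\<close>
    show "p' < 2" if "p > 2 \<and> p' = 1 / (1 - 1 / p)" for p p' :: real
      using p'[of p p' 1] that by simp
    show "{\<gamma>. spherical adj v0 \<gamma> \<in> lp_space p} - {0} =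
        {\<gamma>. qgeo qp qm powr (1 / p - 1 / p') < B_abs qp qm R \<gamma> \<and>
             B_abs qp qm R \<gamma> < qgeo qp qm powr (1 / p' - 1 / p)} - {0}"
      if "p > 2 \<and> p' = 1 / (1 - 1 / p)" for p p'
      using lp[of p p'] that unfolding q_def by blast
    show "{\<gamma>. spherical adj v0 \<gamma> \<in> (\<Inter>p\<in>{2<..}. lp_space p)} - {0} =
       {\<gamma>. B_abs qp qm R \<gamma> = 1} - {0}"
      using inter by auto
    show "{\<gamma>. bounded (range (spherical adj v0 \<gamma>))} =
       {\<gamma>. 1 / qgeo qp qm \<le> B_abs qp qm R \<gamma> \<and> B_abs qp qm R \<gamma> \<le> qgeo qp qm}"
      using bounded unfolding q_def by blast
  qed (use unique_l2 zero_l2 unique_crit spherical_0_in_lp continuous discrete_spectrum_iff in auto)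
qed

end
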